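(* Let $n=2$ and let $a\in C(\mathbb{T}^2,(0,\infty))$. Then $\partial S_a$ does not contain a line segment of irrational slope. Equivalently, $\partial D_a$ is differentiable at every irrational point, i.e. at every $x\in\partial D_a$ that is not a real multiple of a vector in $\mathbb{Z}^2$ the convex set $D_a$ has a unique supporting line.
   Context: $\mathbb{T}^2=\mathbb{R}^2/\mathbb{Z}^2$; functions on $\mathbb{T}^2$ are identified with $\mathbb{Z}^2$-periodic functions on $\mathbb{R}^2$. For $a\in C(\mathbb{T}^2,(0,\infty))$ and $p\in\mathbb{R}^2$, the effective Hamiltonian $\overline H_a(p)$ is the unique constant such that the cell problem $a(y)|p+Dv(y)|=\overline H_a(p)$ in $\mathbb{T}^2$ has a continuous $\mathbb{Z}^2$-periodic viscosity solution $v$; equivalently $\overline H_a(p)=\inf_{\phi\in C^1(\mathbb{T}^2)}\max_{y\in\mathbb{T}^2}a(y)|p+D\phi(y)|$. $\overline H_a$ is convex, even and positively $1$-homogeneous. Set $S_a=\{p\in\mathbb{R}^2:\overline H_a(p)\le1\}$ and $D_a=\partial\overline H_a(0)$ (the subdifferential of $\overline H_a$ at $0$, called the effective front). A line segment in $\mathbb{R}^2$ has irrational slope if its direction vector is not a real multiple of a vector in $\mathbb{Z}^2$. *)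

theory Defs
  imports "HOL-Analysis.Analysis"
begin

text \<open>Points of R^2 are vectors of type real^2; functions on T^2 are
  Z^2-periodic functions on R^2.\<close>

definition int_vec :: "real^2 \<Rightarrow> bool" where
  "int_vec k \<longleftrightarrow> (\<forall>i. k $ i \<in> \<int>)"

definition periodic2 :: "(real^2 \<Rightarrow> 'b) \<Rightarrow> bool" where
  "periodic2 f \<longleftrightarrow> (\<forall>y k. int_vec k \<longrightarrow> f (y + k) = f y)"

definition C1_torus_grad :: "(real^2 \<Rightarrow> real) \<Rightarrow> (real^2 \<Rightarrow> real^2) \<Rightarrow> bool" where
  "C1_torus_grad phi g \<longleftrightarrow> periodic2 phi \<and> continuous_on UNIV g \<and>
     (\<forall>y. (phi has_derivative (\<lambda>h. g y \<bullet> h)) (at y))"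

text \<open>Effective Hamiltonian via the inf-max formula:
  inf over C^1 periodic phi of max_y a(y) |p + D phi(y)|.\<close>
definition eff_H :: "(real^2 \<Rightarrow> real) \<Rightarrow> real^2 \<Rightarrow> real" where
  "eff_H a p = (INF g \<in> {g. \<exists>phi. C1_torus_grad phi g}.
                   (SUP y. a y * norm (p + g y)))"

definition S_set :: "(real^2 \<Rightarrow> real) \<Rightarrow> (real^2) set" where
  "S_set a = {p. eff_H a p \<le> 1}"

definition D_set :: "(real^2 \<Rightarrow> real) \<Rightarrow> (real^2) set" where
  "D_set a = {x. \<forall>p. eff_H a p \<ge> eff_H a 0 + x \<bullet> p}"

definition rational_dir :: "real^2 \<Rightarrow> bool" where
  "rational_dir v \<longleftrightarrow> (\<exists>c k. int_vec k \<and> v = c *\<^sub>R k)"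

end

theory Submission
  imports Defs
begin

text \<open>Write \<open>b = 1 / a\<close> and let \<open>d\<close> be the \<open>\<int>\<^sup>2\<close>-periodic distance with line element \<open>b |dx|\<close>.
  Then \<open>H(p) \<le> \<Lambda>\<close> iff \<open>p \<bullet> k \<le> \<Lambda> d(0, k)\<close> for all integer vectors \<open>k\<close>. Suppose \<open>H(p0), H(p1) \<le> 1\<close>
  and that \<open>e = p1 - p0\<close> is irrational; let \<open>p\<close> be the midpoint. A loop of class \<open>k\<close> has length at least
  \<open>max (p0 \<bullet> k) (p1 \<bullet> k) = p \<bullet> k + |e \<bullet> k| / 2\<close>. There are arbitrarily large \<open>m\<close> such that
  \<open>|e \<bullet> k| \<ge> c / m\<close> whenever \<open>0 < k\<^sub>1 < m\<close>. On the other hand, a shortest path that makes \<open>m\<close> steps in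
  the first direction passes twice through a thin vertical strip (modulo \<open>\<int>\<^sup>2\<close>) at distance \<open>O(1/m)\<close>, and
  since \<open>b\<close> is continuous, exchanging the two passages costs only \<open>o(1/m)\<close>. This splits off a loop of
  class \<open>k\<close> with \<open>0 < k\<^sub>1 < m\<close>. By induction every loop of class \<open>K\<close> is longer than \<open>p \<bullet> K\<close> by a fixed
  proportion, hence \<open>H(p) < 1\<close>. The differentiability of the front follows by duality.\<close>

section \<open>Elementary facts\<close>

lemma real2_eqI: "x $ 1 = y $ 1 \<Longrightarrow> x $ 2 = y $ 2 \<Longrightarrow> x = y" for x y :: "real^2"
  by (simp add: vec_eq_iff forall_2)

lemma inner_real2: "x \<bullet> y = x $ 1 * y $ 1 + x $ 2 * y $ 2" for x y :: "real^2"
  by (simp add: inner_vec_def sum_2)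

lemma norm_real2: "norm x = sqrt ((x $ 1)\<^sup>2 + (x $ 2)\<^sup>2)" for x :: "real^2"
  by (simp add: norm_eq_sqrt_inner inner_real2 power2_eq_square)

lemma norm_real2_le: "norm x \<le> \<bar>x $ 1\<bar> + \<bar>x $ 2\<bar>" for x :: "real^2"
  using norm_le_l1_cart[of x] by (simp add: sum_2)

lemma int_vec_vector: "int_vec (vector [of_int m, of_int n])"
  by (simp add: int_vec_def forall_2)

lemma int_vec_0: "int_vec 0"
  and int_vec_add: "int_vec k \<Longrightarrow> int_vec l \<Longrightarrow> int_vec (k + l)"
  and int_vec_diff: "int_vec k \<Longrightarrow> int_vec l \<Longrightarrow> int_vec (k - l)"
  and int_vec_minus: "int_vec k \<Longrightarrow> int_vec (- k)"
  by (auto simp: int_vec_def)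

lemma periodic2D: "periodic2 f \<Longrightarrow> int_vec k \<Longrightarrow> f (y + k) = f y"
  by (simp add: periodic2_def)

section \<open>Reduction of periodic functions to the unit square\<close>

lemma shift_to_unit_square:
  obtains k where "int_vec k" "y - k \<in> cbox 0 (1 :: real^2)"
proof
  show "int_vec (vector [of_int \<lfloor>y $ 1\<rfloor>, of_int \<lfloor>y $ 2\<rfloor>])"
    by (rule int_vec_vector)
  show "y - vector [of_int \<lfloor>y $ 1\<rfloor>, of_int \<lfloor>y $ 2\<rfloor>] \<in> cbox 0 (1 :: real^2)"
    by (auto simp: mem_box_cart forall_2) linarith+
qed

lemma periodic2_bounded:
  fixes f :: "real^2 \<Rightarrow> real"
  assumes "continuous_on UNIV f" "periodic2 f"
  obtains u v where "\<And>y. f u \<le> f y" "\<And>y. f y \<le> f v"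
proof -
  have c: "continuous_on (cbox 0 (1 :: real^2)) f"
    using assms(1) continuous_on_subset by blast
  have ne: "cbox 0 (1 :: real^2) \<noteq> {}"
    by (simp add: interval_ne_empty_cart)
  obtain u where u: "\<And>y. y \<in> cbox 0 1 \<Longrightarrow> f u \<le> f y"
    using continuous_attains_inf[OF compact_cbox ne c] by blast
  obtain v where v: "\<And>y. y \<in> cbox 0 1 \<Longrightarrow> f y \<le> f v"
    using continuous_attains_sup[OF compact_cbox ne c] by blast
  have "f u \<le> f y \<and> f y \<le> f v" for y
  proof -
    obtain k where "int_vec k" "y - k \<in> cbox 0 (1 :: real^2)"
      using shift_to_unit_square by blast
    then show ?thesis
      using u v periodic2D[OF assms(2), of k "y - k"] by force
  qed
  then show ?thesis
    using that by blast
qed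

text \<open>Compactness of one ball suffices: an integer translation puts \<open>y\<close> within
  distance 2 of the origin, and capping \<open>d\<close> at 1 keeps \<open>z\<close> within distance
  3.\<close>

lemma periodic2_uniformly_continuous:
  fixes f :: "real^2 \<Rightarrow> real"
  assumes "continuous_on UNIV f" "periodic2 f" "e > 0"
  obtains d where "d > 0" "\<And>y z. norm (z - y) < d \<Longrightarrow> \<bar>f z - f y\<bar> < e"
proof -
  have "uniformly_continuous_on (cball 0 (3::real)) f"
    using assms(1) by (intro compact_uniformly_continuous) (auto intro: continuous_on_subset)
  then obtain d where d: "d > 0"
    "\<And>y z. y \<in> cball 0 3 \<Longrightarrow> z \<in> cball 0 3 \<Longrightarrow> dist z y < d \<Longrightarrow> dist (f z) (f y) < e"
    using assms(3) unfolding uniformly_continuous_on_def by metis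
  have "\<bar>f z - f y\<bar> < e" if yz: "norm (z - y) < min d 1" for y z
  proof -
    obtain k where k: "int_vec k" "y - k \<in> cbox 0 (1 :: real^2)"
      using shift_to_unit_square by blast
    have "norm (y - k) \<le> 2"
      using norm_real2_le[of "y - k"] k(2) by (auto simp: mem_box_cart forall_2)
    moreover have "norm (z - k) \<le> norm (y - k) + norm (z - y)"
      using norm_triangle_ineq[of "y - k" "z - y"] by simp
    ultimately have "dist (f (z - k)) (f (y - k)) < e"
      using yz by (intro d(2)) (auto simp: dist_norm norm_minus_commute[of k])
    then show ?thesis
      using periodic2D[OF assms(2) k(1), of "y - k"] periodic2D[OF assms(2) k(1), of "z - k"]
      by (simp add: dist_real_def)
  qed
  then show ?thesis
    using d(1) that[of "min d 1"] by simp
qed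

lemma segment_split_at_coordinate:
  fixes y z :: "real^2"
  assumes "y $ 1 \<le> t" "t \<le> z $ 1"
  obtains w where "w \<in> closed_segment y z" "w $ 1 = t"
proof -
  have "continuous_on (closed_segment y z) (\<lambda>w. w $ 1)"
    by (intro continuous_intros)
  then have "connected ((\<lambda>w. w $ 1) ` closed_segment y z)"
    by (rule connected_continuous_image) simp
  then have "t \<in> (\<lambda>w. w $ 1) ` closed_segment y z"
    using assms by (meson connectedD_interval ends_in_segment image_eqI)
  then show ?thesis
    using that by blast
qed

text \<open>No order between \<open>x\<close> and \<open>y\<close> is assumed, because the
  increments in the second difference below have arbitrary signs.\<close>

lemma mvt_real_line:
  fixes f f' :: "real \<Rightarrow> real"
  assumes "\<And>x. (f has_real_derivative f' x) (at x)"
  shows "\<exists>\<xi>. f y - f x = (y - x) * f' \<xi>"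
proof (cases x y rule: linorder_cases)
  case less
  then show ?thesis
    using MVT2[of x y f f'] assms by blast
next
  case greater
  then obtain \<xi> where "f x - f y = (x - y) * f' \<xi>"
    using MVT2[of y x f f'] assms by blast
  then show ?thesis
    by (intro exI[of _ \<xi>]) (simp add: algebra_simps)
qed auto

text \<open>\<open>f t\<close> is the length of a segment with horizontal leg \<open>r\<close> and
  vertical leg \<open>t\<close>. Two applications of the mean value theorem turn the mixed second
  difference into \<open>u * v\<close> times a value of the second derivative of \<open>f\<close>,
  which lies between 0 and \<open>1 / r\<close>. If \<open>u * v\<close> is negative, convexity
  alone suffices, hence the \<open>max\<close>.\<close>

lemma sqrt_second_difference:
  fixes r s u v :: real
  assumes "r > 0"
  defines "f \<equiv> \<lambda>t. sqrt (r\<^sup>2 + t\<^sup>2)"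
  shows "f (s + v) + f (s - u) \<le> f s + f (s + v - u) + max 0 (u * v) / r"
proof -
  have pos: "r\<^sup>2 + t\<^sup>2 > 0" for t
    using assms by (simp add: add_pos_nonneg)
  have fpos: "f t > 0" and f_ge: "f t \<ge> r" for t
    using pos assms by (auto simp: f_def real_le_rsqrt)
  have f_sq: "f t * f t = r\<^sup>2 + t\<^sup>2" for t
    using pos[of t] by (simp add: f_def)
  have f1: "(f has_real_derivative t / f t) (at t)" for t
    unfolding f_def using pos[of t] by (auto intro!: derivative_eq_intros simp: field_simps)
  have f2: "((\<lambda>t. t / f t) has_real_derivative r\<^sup>2 / (r\<^sup>2 + t\<^sup>2) / f t) (at t)" for t
  proof -
    have "((\<lambda>t. t / f t) has_real_derivative (1 * f t - t * (t / f t)) / (f t * f t)) (at t)"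
      using fpos[of t] by (intro DERIV_divide DERIV_ident f1) auto
    moreover have "(1 * f t - t * (t / f t)) / (f t * f t) = r\<^sup>2 / (r\<^sup>2 + t\<^sup>2) / f t"
      using fpos[of t] f_sq[of t] pos[of t] by (simp add: field_simps power2_eq_square)
    ultimately show ?thesis by simp
  qed
  have f2_bounds: "0 \<le> r\<^sup>2 / (r\<^sup>2 + t\<^sup>2) / f t" "r\<^sup>2 / (r\<^sup>2 + t\<^sup>2) / f t \<le> 1 / r" for t
  proof -
    show "0 \<le> r\<^sup>2 / (r\<^sup>2 + t\<^sup>2) / f t"
      using pos[of t] fpos[of t] by simp
    have "r\<^sup>2 / (r\<^sup>2 + t\<^sup>2) \<le> 1"
      using pos[of t] by simp
    then show "r\<^sup>2 / (r\<^sup>2 + t\<^sup>2) / f t \<le> 1 / r"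
      using f_ge[of t] assms(1) by (intro frac_le) auto
  qed
  obtain \<xi> where \<xi>: "(f (s + v) - f (s + v - u)) - (f s - f (s - u)) = v * (\<xi> / f \<xi> - (\<xi> - u) / f (\<xi> - u))"
  proof -
    have "((\<lambda>t. f t - f (t - u)) has_real_derivative t / f t - (t - u) / f (t - u)) (at t)" for t
      using DERIV_shift[of f "(t - u) / f (t - u)" t "- u"] f1[of "t - u"]
      by (intro DERIV_diff f1) auto
    from mvt_real_line[of "\<lambda>t. f t - f (t - u)", OF this, of "s + v" s] show ?thesis
      using that by auto
  qed
  obtain \<zeta> where \<zeta>: "\<xi> / f \<xi> - (\<xi> - u) / f (\<xi> - u) = u * (r\<^sup>2 / (r\<^sup>2 + \<zeta>\<^sup>2) / f \<zeta>)"
    using mvt_real_line[of "\<lambda>t. t / f t", OF f2, of \<xi> "\<xi> - u"] by auto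
  define c where "c = r\<^sup>2 / (r\<^sup>2 + \<zeta>\<^sup>2) / f \<zeta>"
  have "(f (s + v) - f (s + v - u)) - (f s - f (s - u)) = (u * v) * c"
    using \<xi> \<zeta> by (simp add: c_def)
  also have "\<dots> \<le> max 0 (u * v) * c"
    using f2_bounds[of \<zeta>] by (intro mult_right_mono) (auto simp: c_def)
  also have "\<dots> \<le> max 0 (u * v) * (1 / r)"
    using f2_bounds[of \<zeta>] by (intro mult_left_mono) (auto simp: c_def)
  finally show ?thesis
    by simp
qed

text \<open>Sort the points by the fractional part of \<open>\<alpha>\<close>. Going once around the circle, the
  increments of \<open>\<alpha>\<close> and of \<open>\<beta>\<close> both add up to 1.\<close>

lemma close_pair_on_circle:
  fixes \<alpha> \<beta> :: "nat \<Rightarrow> real"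
  assumes "finite G" "card G \<ge> 2"
  obtains i j c where "i \<in> G" "j \<in> G" "i < j"
    "(\<alpha> j + of_int c - \<alpha> i) * (\<beta> j + of_int c - \<beta> i) \<le> 1 / (real (card G))\<^sup>2"
    "\<bar>\<alpha> j + of_int c - \<alpha> i\<bar> \<le> 1 / real (card G) + \<bar>(\<beta> j - \<beta> i) - (\<alpha> j - \<alpha> i)\<bar> / 2"
proof -
  define n where "n = card G"
  define xs where "xs = sort_key (\<lambda>i. frac (\<alpha> i)) (sorted_list_of_set G)"
  have xs: "distinct xs" "set xs = G" "length xs = n"
    using assms(1) by (auto simp: xs_def n_def)
  have sorted: "sorted (map (\<lambda>i. frac (\<alpha> i)) xs)"
    by (simp add: xs_def)
  define A where "A k = frac (\<alpha> (xs ! k))" for k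
  \<comment> \<open>\<open>\<beta>\<close> is reduced by the integer part of
    \<open>\<alpha>\<close>, not by its own, so that one integer \<open>c\<close> serves both
    increments.\<close>
  define B where "B k = \<beta> (xs ! k) - of_int \<lfloor>\<alpha> (xs ! k)\<rfloor>" for k
  \<comment> \<open>The step from the last point back to the first closes the circle and adds one
    full turn.\<close>
  define wrap :: "nat \<Rightarrow> nat" where "wrap k = (if k = n - 1 then 1 else 0)" for k
  define nxt where "nxt k = (if k = n - 1 then 0 else Suc k)" for k
  define x where "x k = A (nxt k) + real (wrap k) - A k" for k
  define y where "y k = B (nxt k) + real (wrap k) - B k" for k
  have n: "n \<ge> 2"
    using assms(2) by (simp add: n_def)
  have x_nonneg: "x k \<ge> 0" if "k < n" for k
  proof (cases "k = n - 1")
    case True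
    then have "x k = frac (\<alpha> (xs ! 0)) + 1 - frac (\<alpha> (xs ! k))"
      by (simp add: x_def A_def nxt_def wrap_def)
    then show ?thesis
      using frac_ge_0[of "\<alpha> (xs ! 0)"] frac_lt_1[of "\<alpha> (xs ! k)"] by linarith
  next
    case False
    then have "Suc k < length xs"
      using that xs by auto
    then have "A k \<le> A (Suc k)"
      using sorted_nth_mono[OF sorted, of k "Suc k"] by (simp add: A_def)
    then show ?thesis
      using False by (simp add: x_def nxt_def wrap_def)
  qed
  have telescope: "(\<Sum>k<n. F (nxt k) + real (wrap k) - F k) = 1" for F :: "nat \<Rightarrow> real"
  proof -
    obtain l where l: "n = Suc l"
      using n by (cases n) auto
    have "(\<Sum>k<l. F (nxt k) + real (wrap k) - F k) = (\<Sum>k<l. F (Suc k) - F k)"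
      by (intro sum.cong) (auto simp: nxt_def wrap_def l)
    also have "\<dots> = F l - F 0"
      by (rule sum_lessThan_telescope)
    finally show ?thesis
      by (simp add: l nxt_def wrap_def)
  qed
  \<comment> \<open>The \<open>n\<close> sums \<open>x k + y k\<close> add up to 2, so one of them
    is at most the average.\<close>
  have "\<exists>k<n. x k + y k \<le> 2 / n"
  proof (rule ccontr)
    assume "\<not> ?thesis"
    then have "(\<Sum>k<n. 2 / real n) < (\<Sum>k<n. x k + y k)"
      using n by (intro sum_strict_mono) (auto simp: lessThan_empty_iff)
    moreover have "(\<Sum>k<n. x k + y k) = 2"
      unfolding sum.distrib x_def y_def telescope by simp
    ultimately show False
      using n by simp
  qed
  then obtain k where k: "k < n" "x k + y k \<le> 2 / n"
    by blast
  have nk: "nxt k < n" "nxt k \<noteq> k"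
    using k n by (auto simp: nxt_def)
  define i where "i = xs ! k"
  define j where "j = xs ! nxt k"
  define c where "c = \<lfloor>\<alpha> i\<rfloor> - \<lfloor>\<alpha> j\<rfloor> + int (wrap k)"
  have ij: "i \<in> G" "j \<in> G" "i \<noteq> j"
    using xs k nk by (auto simp: i_def j_def nth_eq_iff_index_eq)
  have xk: "x k = \<alpha> j + of_int c - \<alpha> i" and yk: "y k = \<beta> j + of_int c - \<beta> i"
    by (auto simp: x_def y_def A_def B_def i_def j_def c_def frac_def)
  \<comment> \<open>The arithmetic-geometric mean inequality. Only \<open>x k\<close> is known to be
    nonnegative, since the points are not sorted by \<open>\<beta>\<close>; a negative
    \<open>y k\<close> makes the product nonpositive.\<close>
  have prod: "x k * y k \<le> 1 / (real n)\<^sup>2"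
  proof (cases "y k \<ge> 0")
    case True
    have "x k * y k \<le> ((x k + y k) / 2)\<^sup>2"
      using sum_squares_bound[of "x k" "y k"] by (simp add: power2_eq_square algebra_simps)
    also have "\<dots> \<le> (1 / real n)\<^sup>2"
      using True x_nonneg[OF k(1)] k(2) by (intro power_mono) auto
    finally show ?thesis
      by (simp add: power_divide)
  next
    case False
    then have "x k * y k \<le> 0"
      using x_nonneg[OF k(1)] by (simp add: mult_nonneg_nonpos)
    then show ?thesis
      by (smt (verit) divide_nonneg_nonneg zero_le_power2)
  qed
  have absx: "\<bar>x k\<bar> \<le> 1 / real n + \<bar>y k - x k\<bar> / 2"
  proof -
    have "(x k + y k) / 2 \<le> 1 / real n"
      using k(2) by simp
    moreover have "\<bar>x k\<bar> \<le> (x k + y k) / 2 + \<bar>y k - x k\<bar> / 2"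
      using x_nonneg[OF k(1)] by (simp add: abs_if field_simps)
    ultimately show ?thesis
      by linarith
  qed
  have diff: "y k - x k = (\<beta> j - \<beta> i) - (\<alpha> j - \<alpha> i)"
    by (simp add: xk yk)
  \<comment> \<open>Neighbours on the circle may come in either index order. Swapping them and
    negating \<open>c\<close> changes the sign of both factors, so the product is unchanged.\<close>
  show ?thesis
  proof (cases "i < j")
    case True
    then show ?thesis
      using that[OF ij(1,2)] prod[unfolded xk yk n_def] absx[unfolded diff, unfolded xk n_def] by blast
  next
    case False
    have "(\<alpha> i + of_int (- c) - \<alpha> j) * (\<beta> i + of_int (- c) - \<beta> j) = x k * y k"
      by (simp add: xk yk algebra_simps)
    moreover have "\<bar>\<alpha> i + of_int (- c) - \<alpha> j\<bar> = \<bar>x k\<bar>"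
      by (simp add: xk)
    moreover have "\<bar>(\<beta> i - \<beta> j) - (\<alpha> i - \<alpha> j)\<bar> = \<bar>y k - x k\<bar>"
      unfolding diff by simp
    ultimately show ?thesis
      using that[of j i "- c"] ij prod absx False by (simp add: n_def)
  qed
qed

text \<open>As for convergents of continued fractions: \<open>m\<close> is the first denominator
  that beats the best approximation \<open>h j0\<close> among the denominators up to
  \<open>N + 1\<close>. All smaller denominators then have error at least \<open>h j0\<close>, and
  the integer determinant of the approximations with denominators \<open>j0\<close> and
  \<open>m\<close> bounds \<open>h j0\<close> from below.\<close>

lemma badly_approximated_below:
  fixes \<theta> :: real and N :: nat
  assumes "\<theta> \<notin> \<rat>"
  obtains m where "m \<ge> N" "m > 0"
    "\<And>(j::nat) c::int. 0 < j \<Longrightarrow> j < m \<Longrightarrow> 1 / (2 * real m) \<le> \<bar>real j * \<theta> - of_int c\<bar>"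
proof -
  define h where "h j = \<bar>real j * \<theta> - of_int (round (real j * \<theta>))\<bar>" for j :: nat
  have h_le: "h j \<le> \<bar>real j * \<theta> - of_int c\<bar>" for j c
    unfolding h_def by (rule round_diff_minimal)
  have nonzero: "real j * \<theta> \<noteq> of_int c" if "j > 0" for j :: nat and c :: int
  proof
    assume "real j * \<theta> = of_int c"
    then have "\<theta> = of_int c / of_int (int j)"
      using that by (simp add: field_simps)
    then show False
      using assms by (metis Rats_divide Rats_of_int)
  qed
  obtain j0 where j0: "j0 \<in> {1..N + 1}" "\<And>j. j \<in> {1..N + 1} \<Longrightarrow> h j0 \<le> h j"
    using ex_is_arg_min_if_finite[of "{1..N + 1}" h] by (auto simp: is_arg_min_linorder)
  have hj0: "h j0 > 0"
    using nonzero[of j0] j0(1) by (auto simp: h_def)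
  have "\<exists>j>0. h j < h j0"
  proof -
    obtain N' :: nat where N': "N' > 0" "1 / real N' < h j0"
      using hj0 by (metis inverse_eq_divide reals_Archimedean zero_less_Suc)
    obtain q p where qp: "0 < q" "\<bar>of_int q * \<theta> - of_int p\<bar> < 1 / N'"
      using Dirichlet_approx_simult[OF N'(1), of 1 "\<lambda>_. \<theta>"] by (metis zero_less_one)
    then have "h (nat q) < h j0"
      using h_le[of "nat q" p] N'(2) by simp
    then show ?thesis
      using qp(1) by (intro exI[of _ "nat q"]) auto
  qed
  define m where "m = (LEAST j. j > 0 \<and> h j < h j0)"
  have m: "m > 0" "h m < h j0"
    unfolding m_def using LeastI_ex[OF \<open>\<exists>j>0. h j < h j0\<close>] by auto
  have least: "h j0 \<le> h j" if "0 < j" "j < m" for j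
    using not_less_Least[of j "\<lambda>j. j > 0 \<and> h j < h j0"] that unfolding m_def by auto
  have "\<not> m \<le> N + 1"
    using j0(2)[of m] m by auto
  then have "m \<ge> N" "j0 < m"
    using j0(1) by auto
  have "1 / (2 * real m) \<le> h j0"
  proof -
    define b0 where "b0 = round (real j0 * \<theta>)"
    define b where "b = round (real m * \<theta>)"
    define \<delta> where "\<delta> = real j0 * \<theta> - of_int b0"
    define \<eta> where "\<eta> = real m * \<theta> - of_int b"
    have abs: "\<bar>\<delta>\<bar> = h j0" "\<bar>\<eta>\<bar> < h j0"
      using m(2) by (auto simp: h_def \<delta>_def \<eta>_def b0_def b_def)
    have eq: "real j0 * \<eta> - real m * \<delta> = of_int (int m * b0 - int j0 * b)"
      by (simp add: \<delta>_def \<eta>_def algebra_simps)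
    have le: "\<bar>real j0 * \<eta>\<bar> \<le> real m * h j0" "\<bar>real m * \<delta>\<bar> = real m * h j0"
      using abs \<open>j0 < m\<close> by (auto simp: abs_mult intro!: mult_mono)
    \<comment> \<open>If the determinant vanished, \<open>m * \<delta>\<close> and
      \<open>j0 * \<eta>\<close> would agree in absolute value, although \<open>j0 < m\<close> and
      \<open>\<eta>\<close> is the smaller error.\<close>
    have "int m * b0 - int j0 * b \<noteq> 0"
    proof
      assume "int m * b0 - int j0 * b = 0"
      then have "\<bar>real m * \<delta>\<bar> = \<bar>real j0 * \<eta>\<bar>"
        using eq by simp
      also have "\<dots> = real j0 * \<bar>\<eta>\<bar>"
        by (simp add: abs_mult)
      also have "\<dots> < real m * h j0"
        using abs \<open>j0 < m\<close> j0(1) hj0 by (intro mult_less_le_imp_less mult_strict_mono) auto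
      finally show False
        using le(2) by simp
    qed
    then have "1 \<le> \<bar>real j0 * \<eta> - real m * \<delta>\<bar>"
      unfolding eq by linarith
    also have "\<dots> \<le> 2 * real m * h j0"
      using le by linarith
    finally show ?thesis
      using m(1) by (simp add: field_simps)
  qed
  then show ?thesis
    using that[OF \<open>m \<ge> N\<close> m(1)] least h_le by (meson order_trans)
qed

section \<open>Averaging over progressions of strips\<close>

lemma sum_lessThan_shift: "(\<Sum>i<q. f (a + i)) = sum f {a..<a + q}"
  for f :: "nat \<Rightarrow> 'a::comm_monoid_add"
  by (induction q) auto

text \<open>The first \<open>B * m * q\<close> strips, \<open>B = M div m\<close>, are partitioned
  into \<open>B * q\<close> progressions, one for each block \<open>W\<close> of \<open>m\<close>
  unit periods and each residue \<open>\<rho>\<close> modulo \<open>q\<close>. Since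
  \<open>M \<le> 2 * B * m\<close>, their average cost is at most the stated bound.\<close>

lemma cheap_progression:
  fixes s :: "nat \<Rightarrow> real"
  assumes s: "\<And>i. s i \<ge> 0" and m: "m > 0" "m \<le> M" and q: "q > 0"
    and C: "C \<ge> 0" "(\<Sum>i<M * q. s i) \<le> C * real M"
  obtains W \<rho> where "W * m + m \<le> M" "\<rho> < q"
    "(\<Sum>j<m. s ((W * m + j) * q + \<rho>)) \<le> 2 * C * real m / real q"
proof -
  define B where "B = M div m"
  define T where "T = 2 * C * real m / real q"
  have B: "B > 0" "B * m \<le> M"
    using m by (auto simp: B_def div_greater_zero_iff)
  have "M < B * m + m"
    using m(1) by (metis B_def add.commute dividend_less_div_times)
  moreover have "m \<le> B * m"
    using B(1) by simp
  ultimately have "M \<le> 2 * (B * m)"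
    by linarith
  then have M2: "real M \<le> 2 * (real B * real m)"
    by (metis of_nat_le_iff of_nat_mult of_nat_numeral)
  have "\<exists>W<B. \<exists>\<rho><q. (\<Sum>j<m. s ((W * m + j) * q + \<rho>)) \<le> T"
  proof (rule ccontr)
    assume "\<not> ?thesis"
    then have gt: "T < (\<Sum>j<m. s ((W * m + j) * q + \<rho>))" if "W < B" "\<rho> < q" for W \<rho>
      using that by (auto simp: not_le)
    have "(\<Sum>W<B. \<Sum>\<rho><q. T) < (\<Sum>W<B. \<Sum>\<rho><q. \<Sum>j<m. s ((W * m + j) * q + \<rho>))"
      using gt B(1) q by (intro sum_strict_mono) (auto simp: lessThan_empty_iff)
    also have "\<dots> = (\<Sum>W<B. \<Sum>j<m. \<Sum>\<rho><q. s ((W * m + j) * q + \<rho>))"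
      by (intro sum.cong refl sum.swap)
    also have "\<dots> = (\<Sum>W<B. \<Sum>i\<in>{W * m..<W * m + m}. sum s {i * q..<i * q + q})"
      by (simp add: sum_lessThan_shift[of "\<lambda>i. sum s {i * q..<i * q + q}", symmetric] sum_lessThan_shift)
    also have "\<dots> = (\<Sum>i<B * m * q. s i)"
      by (simp add: sum.nat_group)
    also have "\<dots> \<le> (\<Sum>i<M * q. s i)"
      using B(2) s by (intro sum_mono2) (auto intro: less_le_trans)
    also have "\<dots> \<le> C * (2 * (real B * real m))"
      using C M2 mult_left_mono order_trans by blast
    finally show False
      using q by (simp add: T_def)
  qed
  then obtain W \<rho> where W: "W < B" and \<rho>: "\<rho> < q" "(\<Sum>j<m. s ((W * m + j) * q + \<rho>)) \<le> T"
    by blast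
  have "Suc W * m \<le> B * m"
    using W by (intro mult_le_mono1) auto
  then show ?thesis
    using that[of W \<rho>] \<rho> B(2) by (simp add: T_def)
qed

lemma markov_half:
  fixes s :: "nat \<Rightarrow> real"
  assumes "\<And>i. s i \<ge> 0" "T > 0" "(\<Sum>j<m. s j) \<le> real m * T"
  shows "real m / 2 \<le> real (card {j. j < m \<and> s j \<le> 2 * T})"
proof -
  let ?G = "{j. j < m \<and> s j \<le> 2 * T}" and ?B = "{j. j < m \<and> 2 * T < s j}"
  have "real (card ?B) * (2 * T) = (\<Sum>j\<in>?B. 2 * T)"
    by simp
  also have "\<dots> \<le> (\<Sum>j\<in>?B. s j)"
    by (intro sum_mono) auto
  also have "\<dots> \<le> (\<Sum>j<m. s j)"
    using assms(1) by (intro sum_mono2) auto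
  finally have "T * (2 * real (card ?B)) \<le> T * real m"
    using assms(3) by (simp add: algebra_simps)
  then have "real (card ?B) \<le> real m / 2"
    using assms(2) by simp
  moreover have "card ?G + card ?B = card (?G \<union> ?B)"
    by (intro card_Un_disjoint[symmetric]) auto
  moreover have "?G \<union> ?B = {..<m}"
    by auto
  ultimately show ?thesis
    by (smt (verit) card_lessThan field_sum_of_halves of_nat_add)
qed

section \<open>The periodic distance\<close>

locale periodic_weight =
  fixes b :: "real^2 \<Rightarrow> real"
  assumes cont_b: "continuous_on UNIV b"
    and b_pos: "b y > 0"
    and per_b: "periodic2 b"
begin

text \<open>\<open>subsolution\<close> encodes \<open>|Du| \<le> b\<close> without derivatives, and \<open>dst\<close> is the distance with line
  element \<open>b |dx|\<close>, introduced by duality so that no curves are needed.\<close>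

definition subsolution :: "(real^2 \<Rightarrow> real) \<Rightarrow> bool" where
  "subsolution u \<longleftrightarrow> (\<forall>y z M. (\<forall>w\<in>closed_segment y z. b w \<le> M) \<longrightarrow> u z - u y \<le> M * norm (z - y))"

definition dst :: "real^2 \<Rightarrow> real^2 \<Rightarrow> real" where
  "dst y z = (SUP u \<in> Collect subsolution. u z - u y)"

lemma subsolutionD: "subsolution u \<Longrightarrow> (\<And>w. w \<in> closed_segment y z \<Longrightarrow> b w \<le> M) \<Longrightarrow> u z - u y \<le> M * norm (z - y)"
  by (auto simp: subsolution_def)

lemma segment_weight_pos: "(\<And>w. w \<in> closed_segment y z \<Longrightarrow> b w \<le> M) \<Longrightarrow> M > 0"
  using b_pos[of y] by (meson ends_in_segment(1) less_le_trans)

definition bmin :: real where "bmin = (INF y. b y)"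
definition bmax :: real where "bmax = (SUP y. b y)"

lemma bmin_le: "bmin \<le> b y"
  unfolding bmin_def
  by (metis periodic2_bounded[OF cont_b per_b] bdd_belowI2 cINF_lower iso_tuple_UNIV_I)

lemma bmax_ge: "b y \<le> bmax"
  unfolding bmax_def
  by (metis periodic2_bounded[OF cont_b per_b] bdd_aboveI2 cSUP_upper iso_tuple_UNIV_I)

lemma bmin_pos: "bmin > 0"
proof -
  obtain u where u: "\<And>y. b u \<le> b y"
    using periodic2_bounded[OF cont_b per_b] by metis
  then have "b u \<le> bmin"
    unfolding bmin_def by (intro cINF_greatest) auto
  then show ?thesis
    using b_pos[of u] by linarith
qed

lemma bmax_pos: "bmax > 0"
  using b_pos[of 0] bmax_ge[of 0] by linarith

lemma subsolution_0: "subsolution (\<lambda>_. 0)"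
  using segment_weight_pos by (force simp: subsolution_def)

lemma subsolution_minus: "subsolution u \<Longrightarrow> subsolution (\<lambda>y. - u y)"
  unfolding subsolution_def
proof (intro allI impI)
  fix y z M
  assume *: "\<forall>y z M. (\<forall>w\<in>closed_segment y z. b w \<le> M) \<longrightarrow> u z - u y \<le> M * norm (z - y)"
    "\<forall>w\<in>closed_segment y z. b w \<le> M"
  then have "u y - u z \<le> M * norm (y - z)"
    by (simp add: closed_segment_commute)
  then show "- u z - - u y \<le> M * norm (z - y)"
    by (simp add: norm_minus_commute)
qed

lemma subsolution_add_const: "subsolution u \<Longrightarrow> subsolution (\<lambda>y. c + u y)"
  by (simp add: subsolution_def)

lemma subsolution_translate:
  assumes "subsolution u" "int_vec k"
  shows "subsolution (\<lambda>y. u (y + k))"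
  unfolding subsolution_def
proof (intro allI impI)
  fix y z M
  assume *: "\<forall>w\<in>closed_segment y z. b w \<le> M"
  have "b w \<le> M" if "w \<in> closed_segment (y + k) (z + k)" for w
  proof -
    have "w - k \<in> closed_segment y z"
      using that closed_segment_translation[of k y z] by (auto simp: add.commute)
    then show ?thesis
      using * periodic2D[OF per_b assms(2), of "w - k"] by auto
  qed
  then show "u (z + k) - u (y + k) \<le> M * norm (z - y)"
    using subsolutionD[OF assms(1), of "y + k" "z + k" M] by simp
qed

lemma subsolution_INF:
  assumes "I \<noteq> {}" "\<And>i. i \<in> I \<Longrightarrow> subsolution (u i)" "\<And>y. bdd_below ((\<lambda>i. u i y) ` I)"
  shows "subsolution (\<lambda>y. INF i\<in>I. u i y)"
  unfolding subsolution_def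
proof (intro allI impI)
  fix y z M
  assume *: "\<forall>w\<in>closed_segment y z. b w \<le> M"
  have "(INF i\<in>I. u i z) - M * norm (z - y) \<le> (INF i\<in>I. u i y)"
  proof (rule cINF_greatest[OF assms(1)])
    fix i assume i: "i \<in> I"
    have "(INF i\<in>I. u i z) \<le> u i z"
      using i assms(3) by (rule cINF_lower[rotated])
    moreover have "u i z - u i y \<le> M * norm (z - y)"
      using subsolutionD[OF assms(2)[OF i]] * by blast
    ultimately show "(INF i\<in>I. u i z) - M * norm (z - y) \<le> u i y"
      by linarith
  qed
  then show "(INF i\<in>I. u i z) - (INF i\<in>I. u i y) \<le> M * norm (z - y)"
    by linarith
qed

section \<open>Metric properties of the periodic distance\<close>

lemma dst_bdd: "bdd_above ((\<lambda>u. u z - u y) ` Collect subsolution)"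
  using subsolutionD bmax_ge by (intro bdd_aboveI2[of _ _ "bmax * norm (z - y)"]) auto

lemma dst_ge: "subsolution u \<Longrightarrow> u z - u y \<le> dst y z"
  unfolding dst_def by (intro cSUP_upper dst_bdd) auto

lemma dst_le: "(\<And>u. subsolution u \<Longrightarrow> u z - u y \<le> c) \<Longrightarrow> dst y z \<le> c"
  unfolding dst_def using subsolution_0 by (intro cSUP_least) auto

lemma dst_le_segment: "(\<And>w. w \<in> closed_segment y z \<Longrightarrow> b w \<le> M) \<Longrightarrow> dst y z \<le> M * norm (z - y)"
  by (intro dst_le subsolutionD)

lemma dst_nonneg: "0 \<le> dst y z"
  using dst_ge[OF subsolution_0] by simp

lemma dst_refl [simp]: "dst y y = 0"
  using dst_le[of y y 0] dst_nonneg[of y y] by force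

lemma dst_triangle: "dst y z \<le> dst y w + dst w z"
  using dst_ge by (intro dst_le) (smt (verit))

lemma dst_commute_le: "dst y z \<le> dst z y"
  using dst_ge[OF subsolution_minus] by (intro dst_le) force

lemma dst_commute: "dst y z = dst z y"
  using dst_commute_le by (simp add: order_antisym)

lemma dst_translate_le: "int_vec k \<Longrightarrow> dst (y + k) (z + k) \<le> dst y z"
  using dst_ge[OF subsolution_translate] by (intro dst_le) force

lemma dst_translate: "int_vec k \<Longrightarrow> dst (y + k) (z + k) = dst y z"
  using dst_translate_le[of k y z] dst_translate_le[of "- k" "y + k" "z + k"]
  by (simp add: int_vec_minus)

lemma subsolution_dst: "subsolution (dst y)"
  unfolding subsolution_def
proof (intro allI impI)
  fix z z' M
  assume "\<forall>w\<in>closed_segment z z'. b w \<le> M"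
  then have "dst z z' \<le> M * norm (z' - z)"
    by (intro dst_le_segment) auto
  then show "dst y z' - dst y z \<le> M * norm (z' - z)"
    using dst_triangle[of y z' z] by linarith
qed

text \<open>The truncated cone with slope \<open>\<beta>\<close> around \<open>y\<close> is an admissible competitor.\<close>

lemma dst_ge_ball:
  assumes "\<And>w. w \<in> cball y (norm (z - y)) \<Longrightarrow> \<beta> \<le> b w"
  shows "\<beta> * norm (z - y) \<le> dst y z"
proof (cases "\<beta> \<le> 0")
  case True
  then show ?thesis
    using dst_nonneg[of y z] by (smt (verit) mult_nonneg_nonneg mult_minus_left norm_ge_zero)
next
  case False
  define u where "u w = \<beta> * min (norm (w - y)) (norm (z - y))" for w
  have "subsolution u"
    unfolding subsolution_def
  proof (intro allI impI)
    fix z1 z2 M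
    assume M: "\<forall>w\<in>closed_segment z1 z2. b w \<le> M"
    show "u z2 - u z1 \<le> M * norm (z2 - z1)"
    proof (cases "norm (z1 - y) \<ge> norm (z - y)")
      \<comment> \<open>Outside the ball the truncated cone already has its maximal value, so it
        cannot increase along the segment. In the other case \<open>z1\<close> lies in the ball, and
        \<open>b z1\<close> forces \<open>\<beta> \<le> M\<close>.\<close>
      case True
      then have "u z2 \<le> u z1"
        using False by (auto simp: u_def)
      moreover have "M * norm (z2 - z1) \<ge> 0"
        using segment_weight_pos[of z1 z2 M] M by auto
      ultimately show ?thesis by linarith
    next
      case near: False
      then have "\<beta> \<le> M"
        using M assms[of z1] ends_in_segment(1)[of z1 z2] by (force simp: dist_norm norm_minus_commute)
      have "u z2 - u z1 \<le> \<beta> * (norm (z2 - y) - norm (z1 - y))"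
        using near False by (auto simp: u_def right_diff_distrib min_def)
      also have "\<dots> \<le> \<beta> * norm (z2 - z1)"
        using False norm_triangle_ineq2[of "z2 - y" "z1 - y"] by (intro mult_left_mono) auto
      also have "\<dots> \<le> M * norm (z2 - z1)"
        using \<open>\<beta> \<le> M\<close> by (intro mult_right_mono) auto
      finally show ?thesis .
    qed
  qed
  then show ?thesis
    using dst_ge[of u z y] by (simp add: u_def)
qed

lemma dst_le_bmax: "dst y z \<le> bmax * norm (z - y)"
  using bmax_ge by (intro dst_le_segment) auto

lemma dst_ge_bmin: "bmin * norm (z - y) \<le> dst y z"
  using bmin_le by (intro dst_ge_ball) auto

lemma subsolution_continuous:
  assumes "subsolution u"
  shows "continuous_on UNIV u"
proof -
  have le: "u z - u y \<le> bmax * norm (z - y)" for y z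
    using bmax_ge by (intro subsolutionD[OF assms]) auto
  have "dist (u y) (u z) \<le> bmax * dist y z" for y z
    using le[of y z] le[of z y]
    by (simp add: dist_norm dist_real_def norm_minus_commute abs_le_iff)
  then have "bmax-lipschitz_on UNIV u"
    using bmax_pos by (intro lipschitz_onI) auto
  then show ?thesis
    by (rule lipschitz_on_continuous_on)
qed

text \<open>Gluing \<open>dst y\<close> on the left of a vertical line to the distance travelled through that
  line on its right gives an admissible function, so the line is crossed without loss.\<close>

lemma dst_through_line:
  assumes "y $ 1 \<le> t" "t \<le> z $ 1"
  shows "\<exists>w. w $ 1 = t \<and> dst y w + dst w z = dst y z"
proof -
  define I where "I z = (INF w\<in>{w. w $ 1 = t}. dst y w + dst w z)" for z
  have ne: "{w :: real^2. w $ 1 = t} \<noteq> {}"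
    using vector_2(1)[of t 0] by blast
  have bdd: "bdd_below ((\<lambda>w. dst y w + dst w z) ` {w. w $ 1 = t})" for z
    by (intro bdd_belowI2[of _ 0]) (simp add: dst_nonneg)
  have subI: "subsolution I"
    unfolding I_def using ne bdd by (intro subsolution_INF subsolution_add_const subsolution_dst) auto
  \<comment> \<open>On the line the two branches agree, so \<open>U\<close> may be evaluated there
    by either formula.\<close>
  have I_line: "I w = dst y w" if "w $ 1 = t" for w
  proof (rule antisym)
    show "I w \<le> dst y w"
      unfolding I_def using cINF_lower[OF bdd, of w w] that by simp
    show "dst y w \<le> I w"
      unfolding I_def using ne dst_triangle by (intro cINF_greatest) auto
  qed
  define U where "U z = (if z $ 1 \<le> t then dst y z else I z)" for z
  have U_left: "U z = dst y z" if "z $ 1 \<le> t" for z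
    using that by (simp add: U_def)
  have U_right: "U z = I z" if "t \<le> z $ 1" for z
    using that I_line[of z] by (auto simp: U_def)
  \<comment> \<open>A segment meeting both sides is cut at the line; the two bounds add up because
    lengths are additive along a segment.\<close>
  have cross: "U z2 - U z1 \<le> M * norm (z2 - z1)"
    if M: "\<forall>w\<in>closed_segment z1 z2. b w \<le> M" and w: "w \<in> closed_segment z1 z2"
      and le: "U w - U z1 \<le> M * norm (w - z1)" "U z2 - U w \<le> M * norm (z2 - w)" for z1 z2 w M
  proof -
    have "norm (w - z1) + norm (z2 - w) = norm (z2 - z1)"
      using w by (metis between between_mem_segment dist_commute dist_norm)
    then have "M * norm (w - z1) + M * norm (z2 - w) = M * norm (z2 - z1)"
      by (metis distrib_left)
    then show ?thesis
      using le by linarith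
  qed
  have "subsolution U"
    unfolding subsolution_def
  proof (intro allI impI)
    fix z1 z2 M
    assume M: "\<forall>w\<in>closed_segment z1 z2. b w \<le> M"
    have L: "U w2 - U w1 \<le> M * norm (w2 - w1)"
      if "w1 $ 1 \<le> t" "w2 $ 1 \<le> t" "closed_segment w1 w2 \<subseteq> closed_segment z1 z2" for w1 w2
      using that M subsolutionD[OF subsolution_dst[of y], of w1 w2 M] by (auto simp: U_left)
    have R: "U w2 - U w1 \<le> M * norm (w2 - w1)"
      if "w1 $ 1 \<ge> t" "w2 $ 1 \<ge> t" "closed_segment w1 w2 \<subseteq> closed_segment z1 z2" for w1 w2
      using that M subsolutionD[OF subI, of w1 w2 M] by (auto simp: U_right)
    consider "z1 $ 1 \<le> t" "z2 $ 1 \<le> t" | "z1 $ 1 \<ge> t" "z2 $ 1 \<ge> t"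
      | "z1 $ 1 \<le> t" "t \<le> z2 $ 1" | "z2 $ 1 \<le> t" "t \<le> z1 $ 1"
      by linarith
    then show "U z2 - U z1 \<le> M * norm (z2 - z1)"
    proof cases
      case 1
      then show ?thesis by (intro L) auto
    next
      case 2
      then show ?thesis by (intro R) auto
    next
      case 3
      then obtain w where w: "w \<in> closed_segment z1 z2" "w $ 1 = t"
        by (rule segment_split_at_coordinate)
      then have "closed_segment z1 w \<subseteq> closed_segment z1 z2" "closed_segment w z2 \<subseteq> closed_segment z1 z2"
        by (auto simp: subset_closed_segment)
      then show ?thesis
        using 3 w by (intro cross[OF M w(1)] L R) auto
    next
      case 4
      then obtain w where w: "w \<in> closed_segment z2 z1" "w $ 1 = t"
        by (rule segment_split_at_coordinate)
      then have w': "w \<in> closed_segment z1 z2"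
        by (simp add: closed_segment_commute)
      then have "closed_segment z1 w \<subseteq> closed_segment z1 z2" "closed_segment w z2 \<subseteq> closed_segment z1 z2"
        by (auto simp: subset_closed_segment)
      then show ?thesis
        using 4 w by (intro cross[OF M w'] L R) auto
    qed
  qed
  then have "I z \<le> dst y z"
    using dst_ge[of U z y] U_left[OF assms(1)] U_right[OF assms(2)] by simp
  moreover obtain w where w: "w $ 1 = t" "I z = dst y w + dst w z"
  proof -
    define F where "F w = dst y w + dst w z" for w
    obtain w0 :: "real^2" where w0: "w0 $ 1 = t"
      using ne by blast
    \<comment> \<open>Because \<open>F w\<close> is at least \<open>bmin * dist y w\<close>, points
      of the line outside this ball have a larger value than \<open>w0\<close>. A minimum over the
      compact set \<open>C\<close> is therefore a minimum over the whole line.\<close>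
    define C where "C = {w. w $ 1 = t} \<inter> cball y (F w0 / bmin)"
    have out: "bmin * dist y w \<le> F w" for w
      using dst_ge_bmin[of w y] dst_nonneg[of w z] by (simp add: F_def dist_norm norm_minus_commute)
    have "compact C"
      unfolding C_def by (intro closed_Int_compact compact_cball closed_Collect_eq continuous_intros)
    moreover have "w0 \<in> C"
      using w0 out[of w0] bmin_pos by (auto simp: C_def field_simps)
    moreover have "continuous_on C F"
    proof -
      have "F = (\<lambda>w. dst y w + dst z w)"
        by (auto simp: F_def dst_commute)
      then show ?thesis
        using subsolution_continuous[OF subsolution_dst] by (auto intro!: continuous_on_add intro: continuous_on_subset)
    qed
    ultimately obtain w where w: "w \<in> C" "\<And>v. v \<in> C \<Longrightarrow> F w \<le> F v"
      using continuous_attains_inf[of C F] by blast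
    have "F w \<le> F v" if "v $ 1 = t" for v
    proof (cases "v \<in> C")
      case False
      then have "F w0 < bmin * dist y v"
        using that bmin_pos by (auto simp: C_def field_simps)
      then show ?thesis
        using w(2)[OF \<open>w0 \<in> C\<close>] out[of v] by linarith
    qed (use w in auto)
    then have "F w = I z"
      unfolding I_def using w(1) bdd[of z] ne
      by (intro antisym cINF_greatest) (auto simp: F_def C_def intro: cINF_lower)
    then show ?thesis
      using w(1) that[of w] by (auto simp: C_def F_def)
  qed
  ultimately show ?thesis
    using dst_triangle[of y z w] by (intro exI[of _ w]) linarith
qed

end

section \<open>Splitting loops\<close>

context periodic_weight
begin

text \<open>Repeated use of \<open>dst_through_line\<close> on the remaining distance to
  \<open>z\<close>. The equality is exact, so the points \<open>X i\<close> replace the crossings of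
  a shortest curve with vertical lines spaced \<open>1 / q\<close> apart.\<close>

lemma dst_chain_exists:
  assumes "q > 0" "y $ 1 + real n / real q \<le> z $ 1"
  shows "\<exists>X. X 0 = y \<and> (\<forall>i\<le>n. X i $ 1 = y $ 1 + real i / real q) \<and>
    (\<Sum>i<n. dst (X i) (X (Suc i))) + dst (X n) z = dst y z"
  using assms(2)
proof (induction n)
  case 0
  show ?case
    by (intro exI[of _ "\<lambda>_. y"]) auto
next
  case (Suc n)
  have "real n / real q \<le> real (Suc n) / real q"
    by (intro divide_right_mono) auto
  then obtain X where X: "X 0 = y" "\<And>i. i \<le> n \<Longrightarrow> X i $ 1 = y $ 1 + real i / real q"
    "(\<Sum>i<n. dst (X i) (X (Suc i))) + dst (X n) z = dst y z"
    using Suc by auto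
  obtain w where w: "w $ 1 = y $ 1 + real (Suc n) / real q" "dst (X n) w + dst w z = dst (X n) z"
    using dst_through_line[of "X n" "y $ 1 + real (Suc n) / real q" z] Suc.prems X(2)[of n]
      \<open>real n / real q \<le> real (Suc n) / real q\<close> by auto
  define X' where "X' = X(Suc n := w)"
  have "(\<Sum>i<n. dst (X' i) (X' (Suc i))) = (\<Sum>i<n. dst (X i) (X (Suc i)))"
    by (intro sum.cong) (auto simp: X'_def)
  then have "(\<Sum>i<Suc n. dst (X' i) (X' (Suc i))) + dst (X' (Suc n)) z = dst y z"
    using X(3) w(2) by (simp add: X'_def)
  moreover have "X' 0 = y" "\<forall>i\<le>Suc n. X' i $ 1 = y $ 1 + real i / real q"
    using X(1,2) w(1) by (auto simp: X'_def le_Suc_eq)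
  ultimately show ?case
    by blast
qed

lemma dst_le_chain:
  assumes "i \<le> j"
  shows "dst (X i) (X j) \<le> (\<Sum>k\<in>{i..<j}. dst (X k) (X (Suc k)))"
  using assms
proof (induction rule: dec_induct)
  case (step j)
  then show ?case
    using dst_triangle[of "X i" "X (Suc j)" "X j"] by simp
qed simp

text \<open>Two passages through a vertical strip of width \<open>r\<close> exchange their end points. For constant
  \<open>b\<close> the cost is a second difference, bounded by the product of the two vertical gaps over \<open>r\<close>.\<close>

lemma dst_exchange:
  assumes r: "r > 0" and strip: "P' $ 1 = P $ 1" "Q $ 1 = P $ 1 + r" "Q' $ 1 = P $ 1 + r"
    and len: "norm (Q - P) \<le> l" "norm (Q' - P') \<le> l"
    and osc: "\<And>w. w \<in> cball P (\<bar>P' $ 2 - P $ 2\<bar> + l) \<Longrightarrow> \<bar>b w - b P\<bar> \<le> \<omega>"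
  shows "dst P Q' + dst P' Q \<le> dst P Q + dst P' Q' +
    (b P + \<omega>) * (max 0 ((P' $ 2 - P $ 2) * (Q' $ 2 - Q $ 2)) / r) + 4 * \<omega> * l"
proof -
  define u where "u = P' $ 2 - P $ 2"
  define v where "v = Q' $ 2 - Q $ 2"
  define s where "s = Q $ 2 - P $ 2"
  \<comment> \<open>All four segments have horizontal leg \<open>r\<close>; the new vertical legs
    \<open>s + v\<close>, \<open>s - u\<close> and the old ones \<open>s\<close>,
    \<open>s + v - u\<close> have the same sum, as in \<open>sqrt_second_difference\<close>.\<close>
  have norms: "norm (Q' - P) = sqrt (r\<^sup>2 + (s + v)\<^sup>2)" "norm (Q - P') = sqrt (r\<^sup>2 + (s - u)\<^sup>2)"
      "norm (Q - P) = sqrt (r\<^sup>2 + s\<^sup>2)" "norm (Q' - P') = sqrt (r\<^sup>2 + (s + v - u)\<^sup>2)"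
    by (simp_all add: norm_real2 strip s_def u_def v_def algebra_simps)
  have l: "l \<ge> 0"
    using len(1) norm_ge_zero[of "Q - P"] by linarith
  have PP': "norm (P' - P) = \<bar>u\<bar>"
    by (simp add: norm_real2 strip u_def)
  have osc': "b w \<le> b P + \<omega>" "b P - \<omega> \<le> b w" if "norm (w - P) \<le> \<bar>u\<bar> + l" for w
    using osc[of w] that by (auto simp: u_def dist_norm norm_minus_commute)
  have ball: "cball P (\<bar>u\<bar> + l) = {w. norm (w - P) \<le> \<bar>u\<bar> + l}"
    by (auto simp: dist_norm norm_minus_commute)
  have seg: "closed_segment w w' \<subseteq> cball P (\<bar>u\<bar> + l)"
    if "norm (w - P) \<le> \<bar>u\<bar> + l" "norm (w' - P) \<le> \<bar>u\<bar> + l" for w w'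
    using that by (intro closed_segment_subset convex_cball) (auto simp: ball)
  have Q'P: "norm (Q' - P) \<le> \<bar>u\<bar> + l"
    using norm_triangle_ineq[of "Q' - P'" "P' - P"] PP' len by simp
  have "dst P Q' \<le> (b P + \<omega>) * norm (Q' - P)"
    using seg[of P Q'] l Q'P osc'(1) by (intro dst_le_segment) (auto simp: ball)
  moreover have "dst P' Q \<le> (b P + \<omega>) * norm (Q - P')"
  proof (intro dst_le_segment osc'(1))
    have "norm (Q - P) \<le> \<bar>u\<bar> + l"
      using len(1) by linarith
    then show "norm (w - P) \<le> \<bar>u\<bar> + l" if "w \<in> closed_segment P' Q" for w
      using seg[of P' Q] that PP' l by (auto simp: ball)
  qed
  moreover have "(b P - \<omega>) * norm (Q - P) \<le> dst P Q"
    using len(1) l by (intro dst_ge_ball osc'(2)) (auto simp: dist_norm norm_minus_commute)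
  moreover have "(b P - \<omega>) * norm (Q' - P') \<le> dst P' Q'"
  proof (intro dst_ge_ball osc'(2))
    fix w assume "w \<in> cball P' (norm (Q' - P'))"
    then show "norm (w - P) \<le> \<bar>u\<bar> + l"
      using norm_triangle_ineq[of "w - P'" "P' - P"] PP' len(2) by (simp add: dist_norm norm_minus_commute)
  qed
  moreover have "(b P + \<omega>) * (norm (Q' - P) + norm (Q - P')) \<le>
      (b P + \<omega>) * (norm (Q - P) + norm (Q' - P') + max 0 (u * v) / r)"
    using sqrt_second_difference[OF r, of s v u] b_pos[of P] osc'(1)[of P] l
    by (intro mult_left_mono) (auto simp: norms)
  \<comment> \<open>The old segments are bounded below with weight \<open>b P - \<omega>\<close> but
    compared with weight \<open>b P + \<omega>\<close>. The mismatch \<open>2 * \<omega>\<close>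
    times their total length, at most \<open>2 * l\<close>, is the last error term.\<close>
  moreover have "\<omega> * (norm (Q - P) + norm (Q' - P')) \<le> \<omega> * (l + l)"
    using osc'(1)[of P] l len by (intro mult_left_mono add_mono) auto
  ultimately show ?thesis
    unfolding u_def[symmetric] v_def[symmetric] by (simp add: algebra_simps)
qed

text \<open>The strips have width \<open>1 / q\<close> with \<open>q\<close> a small fraction of \<open>m\<close>: wide compared with the
  gaps, which makes the second difference negligible against \<open>1 / m\<close>, but so thin that the
  oscillation of \<open>b\<close> on the scale of the strip costs only \<open>o(1 / m)\<close>. Passages that are too long
  for this are discarded; by averaging, some progression of strips has at least \<open>m / 2\<close> good ones.\<close>

lemma loop_decomposition_step:
  fixes y K :: "real^2" and m q M :: nat
  assumes K: "int_vec K" "K $ 1 = real M" "\<bar>K $ 2\<bar> \<le> L * real M" and L: "L \<ge> 0"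
    and m: "m \<ge> 4" "m \<le> M" and q: "q > 0" "q \<le> m"
    and C1: "C1 = 4 * (bmax * (1 + L)) / bmin"
    and osc: "\<And>w P. norm (w - P) \<le> (2 + 2 * C1) / real q \<Longrightarrow> \<bar>b w - b P\<bar> \<le> \<omega>"
    and \<omega>: "\<omega> \<le> bmax"
  shows "\<exists>k z. int_vec k \<and> 0 < k $ 1 \<and> k $ 1 < real m \<and>
    dst z (z + k) + dst y (y + (K - k)) \<le>
      dst y (y + K) + 8 * bmax * real q / (real m)\<^sup>2 + 4 * \<omega> * C1 / real q"
proof -
  define C where "C = bmax * (1 + L)"
  define r where "r = 1 / real q"
  have C: "C > 0" and r: "r > 0"
    using bmax_pos L q by (auto simp: C_def r_def)
  obtain X where X: "X 0 = y" "\<And>i. i \<le> M * q \<Longrightarrow> X i $ 1 = y $ 1 + real i / real q"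
    and X_sum: "(\<Sum>i<M * q. dst (X i) (X (Suc i))) + dst (X (M * q)) (y + K) = dst y (y + K)"
    using dst_chain_exists[of q y "M * q" "y + K"] q K(2) by auto
  define s where "s i = dst (X i) (X (Suc i))" for i
  have s_nonneg: "s i \<ge> 0" for i
    by (simp add: s_def dst_nonneg)
  have "norm K \<le> (1 + L) * real M"
    using norm_real2_le[of K] K(2,3) by (simp add: algebra_simps)
  then have "bmax * norm K \<le> C * real M"
    using bmax_pos by (simp add: C_def mult.assoc)
  then have "dst y (y + K) \<le> C * real M"
    using dst_le_bmax[of y "y + K"] by simp
  then have s_sum: "(\<Sum>i<M * q. s i) \<le> C * real M"
    using X_sum dst_nonneg[of "X (M * q)" "y + K"] by (simp add: s_def)
  have "m > 0"
    using m(1) by simp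
  obtain W \<rho> where W: "W * m + m \<le> M" "\<rho> < q"
    "(\<Sum>j<m. s ((W * m + j) * q + \<rho>)) \<le> 2 * C * real m / real q"
    by (rule cheap_progression[OF s_nonneg \<open>m > 0\<close> m(2) q(1) less_imp_le[OF C] s_sum])
  \<comment> \<open>These strips are \<open>q\<close> steps, hence horizontal distance 1, apart:
    modulo integer translations they are the same strip.\<close>
  define t where "t j = (W * m + j) * q + \<rho>" for j
  \<comment> \<open>The mean cost in the progression is at most \<open>2 * C * r\<close>. At least
    half of the passages cost no more than twice this, which bounds their length by
    \<open>C1 * r\<close>.\<close>
  define G where "G = {j. j < m \<and> s (t j) \<le> 2 * (2 * C * r)}"
  define n where "n = card G"
  have G_fin: "finite G"
    by (simp add: G_def)
  have n: "real n \<ge> real m / 2"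
    unfolding n_def G_def using s_nonneg C r W(3) by (intro markov_half) (auto simp: t_def r_def mult_ac)
  then have "n \<ge> 2"
    using m(1) by linarith
  have t_less: "Suc (t j) \<le> M * q" if "j < m" for j
  proof -
    have "(W * m + j + 1) * q \<le> M * q"
      using that W(1) by (intro mult_le_mono1) auto
    then show ?thesis
      using W(2) by (simp add: t_def algebra_simps)
  qed
  have t_mono: "Suc (t i) \<le> t j" if "i < j" for i j
  proof -
    have "(i + 1) * q \<le> j * q"
      using that by (intro mult_le_mono1) auto
    then show ?thesis
      using q by (simp add: t_def algebra_simps)
  qed
  have real_t: "real (t j) / real q = real (W * m) + real j + real \<rho> / real q" for j
    using q by (simp add: t_def add_divide_distrib)
  define P where "P j = X (t j)" for j
  define Q where "Q j = X (Suc (t j))" for j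
  have P1: "P j $ 1 = y $ 1 + (real (W * m) + real j + real \<rho> / real q)" if "j < m" for j
    using X(2)[of "t j"] t_less[OF that] real_t[of j] by (simp add: P_def)
  have Q1: "Q j $ 1 = P j $ 1 + r" if "j < m" for j
    using X(2)[of "t j"] X(2)[of "Suc (t j)"] t_less[OF that]
    by (simp add: P_def Q_def r_def add_divide_distrib)
  have len: "norm (Q j - P j) \<le> C1 * r" if "j \<in> G" for j
  proof -
    have "bmin * norm (Q j - P j) \<le> 2 * (2 * C * r)"
      using that dst_ge_bmin[of "Q j" "P j"] by (auto simp: G_def s_def P_def Q_def)
    then show ?thesis
      using bmin_pos by (simp add: C1 C_def field_simps)
  qed
  \<comment> \<open>The entry and exit heights of the good passages are viewed on the vertical
    circle; the two chosen passages are neighbours by entry height.\<close>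
  obtain i j c where ij: "i \<in> G" "j \<in> G" "i < j"
    and prod: "(P j $ 2 + of_int c - P i $ 2) * (Q j $ 2 + of_int c - Q i $ 2) \<le> 1 / (real n)\<^sup>2"
    and gap: "\<bar>P j $ 2 + of_int c - P i $ 2\<bar> \<le> 1 / real n + \<bar>(Q j $ 2 - Q i $ 2) - (P j $ 2 - P i $ 2)\<bar> / 2"
    using close_pair_on_circle[OF G_fin, of "\<lambda>j. P j $ 2" "\<lambda>j. Q j $ 2"] \<open>n \<ge> 2\<close>
    unfolding n_def by metis
  have ijm: "i < m" "j < m"
    using ij by (auto simp: G_def)
  \<comment> \<open>Subtracting \<open>k\<close> moves passage \<open>j\<close> into the strip of
    passage \<open>i\<close>, at the heights compared by the preceding estimate.\<close>
  define k :: "real^2" where "k = vector [of_int (int (j - i)), of_int (- c)]"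
  have k: "int_vec k" "k $ 1 = real j - real i" "k $ 2 = - of_int c"
    unfolding k_def using int_vec_vector[of "int (j - i)" "- c"] ij(3) by (auto simp: of_nat_diff)
  define P' where "P' = P j - k"
  define Q' where "Q' = Q j - k"
  have P'2: "P' $ 2 - P i $ 2 = P j $ 2 + of_int c - P i $ 2"
    and Q'2: "Q' $ 2 - Q i $ 2 = Q j $ 2 + of_int c - Q i $ 2"
    by (auto simp: P'_def Q'_def k)
  have n_inv: "1 / real n \<le> 2 / real m"
    using n m \<open>n \<ge> 2\<close> by (simp add: field_simps)
  have "\<bar>(Q j $ 2 - Q i $ 2) - (P j $ 2 - P i $ 2)\<bar> \<le> 2 * (C1 * r)"
    using component_le_norm_cart[of "Q j - P j" 2] component_le_norm_cart[of "Q i - P i" 2]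
      len[OF ij(1)] len[OF ij(2)] by simp
  moreover have "2 / real m \<le> 2 * r"
    using q m by (simp add: r_def field_simps)
  \<comment> \<open>\<open>1 / n \<le> 2 / m \<le> 2 * r\<close> uses \<open>q \<le> m\<close>, and
    the two passage lengths contribute another \<open>C1 * r\<close> to the gap. The total is the
    radius on which \<open>osc\<close> controls \<open>b\<close>.\<close>
  ultimately have gap': "\<bar>P' $ 2 - P i $ 2\<bar> + C1 * r \<le> (2 + 2 * C1) * r"
    using gap n_inv unfolding P'2 by (simp add: algebra_simps)
  have exchange: "dst (P i) Q' + dst P' (Q i) \<le> dst (P i) (Q i) + dst P' Q' +
      (b (P i) + \<omega>) * (max 0 ((P' $ 2 - P i $ 2) * (Q' $ 2 - Q i $ 2)) / r) + 4 * \<omega> * (C1 * r)"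
  proof (rule dst_exchange[OF r])
    show "P' $ 1 = P i $ 1" "Q i $ 1 = P i $ 1 + r" "Q' $ 1 = P i $ 1 + r"
      using P1[OF ijm(1)] P1[OF ijm(2)] Q1[OF ijm(1)] Q1[OF ijm(2)] by (auto simp: P'_def Q'_def k)
    show "norm (Q i - P i) \<le> C1 * r" "norm (Q' - P') \<le> C1 * r"
      using len ij by (auto simp: P'_def Q'_def)
    fix w assume "w \<in> cball (P i) (\<bar>P' $ 2 - P i $ 2\<bar> + C1 * r)"
    then have "norm (w - P i) \<le> (2 + 2 * C1) / real q"
      using gap' by (simp add: dist_norm norm_minus_commute r_def)
    then show "\<bar>b w - b (P i)\<bar> \<le> \<omega>"
      by (rule osc)
  qed
  have cost: "(b (P i) + \<omega>) * (max 0 ((P' $ 2 - P i $ 2) * (Q' $ 2 - Q i $ 2)) / r) \<le> 8 * bmax * real q / (real m)\<^sup>2"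
  proof -
    \<comment> \<open>The product of gaps is at most \<open>4 / m^2\<close>; dividing by
      \<open>r\<close> gives a factor \<open>q\<close>, and the weight is at most
      \<open>2 * bmax\<close>.\<close>
    have "max 0 ((P' $ 2 - P i $ 2) * (Q' $ 2 - Q i $ 2)) \<le> (1 / real n)\<^sup>2"
      using prod unfolding P'2 Q'2 by (simp add: power_divide)
    also have "\<dots> \<le> (2 / real m)\<^sup>2"
      using n_inv by (intro power_mono) auto
    finally have "max 0 ((P' $ 2 - P i $ 2) * (Q' $ 2 - Q i $ 2)) / r \<le> 4 * real q / (real m)\<^sup>2"
      using q mult_right_mono[of _ "4 / (real m)\<^sup>2" "real q"] by (simp add: r_def power_divide)
    moreover have "0 \<le> \<omega>"
      using osc[of 0 0] C r L bmax_pos bmin_pos by (simp add: C1)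
    ultimately have "(b (P i) + \<omega>) * (max 0 ((P' $ 2 - P i $ 2) * (Q' $ 2 - Q i $ 2)) / r) \<le> (2 * bmax) * (4 * real q / (real m)\<^sup>2)"
      using bmax_ge[of "P i"] \<omega> b_pos[of "P i"] bmax_pos r by (intro mult_mono) auto
    then show ?thesis
      by simp
  qed
  \<comment> \<open>The chain is cut into the two passages and the three stretches before, between
    and after them.\<close>
  have "dst y (P i) + dst (P i) (Q i) + dst (Q i) (P j) + dst (P j) (Q j) + dst (Q j) (y + K) \<le> dst y (y + K)"
  proof -
    define N where "N = M * q"
    have idx: "Suc (t i) \<le> t j" "Suc (t j) \<le> N"
      using t_mono[OF ij(3)] t_less[OF ijm(2)] by (auto simp: N_def)
    have split: "sum s {l..<h} = sum s {l..<o'} + sum s {o'..<h}" if "l \<le> o'" "o' \<le> h" for l o' h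
      using that by (simp add: sum.atLeastLessThan_concat)
    have "sum s {..<N} = sum s {0..<t i} + s (t i) + sum s {Suc (t i)..<t j} + s (t j) + sum s {Suc (t j)..<N}"
      using idx split[of 0 "t i" N] split[of "t i" "Suc (t i)" N] split[of "Suc (t i)" "t j" N]
        split[of "t j" "Suc (t j)" N] by (simp add: atLeast0LessThan)
    moreover have "dst y (P i) \<le> sum s {0..<t i}" "dst (Q i) (P j) \<le> sum s {Suc (t i)..<t j}"
        "dst (Q j) (X N) \<le> sum s {Suc (t j)..<N}"
      using dst_le_chain[of 0 "t i" X] dst_le_chain[OF idx(1), of X] dst_le_chain[OF idx(2), of X] X(1)
      by (auto simp: s_def P_def Q_def)
    moreover have "dst (Q j) (y + K) \<le> dst (Q j) (X N) + dst (X N) (y + K)"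
      by (rule dst_triangle)
    moreover have "sum s {..<N} + dst (X N) (y + K) = dst y (y + K)"
      using X_sum by (simp add: s_def N_def)
    ultimately show ?thesis
      by (simp add: s_def P_def Q_def)
  qed
  moreover have "dst (P j) (Q j) = dst P' Q'"
    using dst_translate[OF int_vec_minus[OF k(1)], of "P j" "Q j"] by (simp add: P'_def Q'_def)
  \<comment> \<open>The split-off loop follows the middle stretch from \<open>Q i\<close> to
    \<open>P j = P' + k\<close> and then the translated exchanged segment to
    \<open>Q i + k\<close>.\<close>
  moreover have "dst (Q i) (Q i + k) \<le> dst (Q i) (P j) + dst P' (Q i)"
    using dst_triangle[of "Q i" "Q i + k" "P j"] dst_translate[OF k(1), of P' "Q i"] by (simp add: P'_def)
  \<comment> \<open>The remaining loop goes from \<open>P i\<close> directly to \<open>Q'\<close>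
    and then follows the last stretch translated by \<open>- k\<close>.\<close>
  moreover have "dst y (y + (K - k)) \<le> dst y (P i) + dst (P i) Q' + dst (Q j) (y + K)"
    using dst_triangle[of y "y + (K - k)" "P i"] dst_triangle[of "P i" "y + (K - k)" Q']
      dst_translate[OF int_vec_minus[OF k(1)], of "Q j" "y + K"] by (simp add: Q'_def algebra_simps)
  ultimately have "dst (Q i) (Q i + k) + dst y (y + (K - k)) \<le>
      dst y (y + K) + 8 * bmax * real q / (real m)\<^sup>2 + 4 * \<omega> * C1 / real q"
    using exchange cost by (simp add: r_def)
  then show ?thesis
    using k(1,2) ij(3) ijm by (intro exI[of _ k] exI[of _ "Q i"]) auto
qed

text \<open>Take \<open>q = m div R\<close>, so that \<open>m / (2 * R) \<le> q \<le> m / R\<close>.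
  A large \<open>R\<close> makes the second-difference error at most
  \<open>\<eta> / (2 * m)\<close>; then a small \<open>\<omega>\<close>, depending on
  \<open>R\<close>, does the same for the oscillation error. Finally large \<open>m\<close> makes
  the strips thin enough for this \<open>\<omega>\<close>.\<close>

lemma loop_decomposition:
  assumes "\<eta> > 0" "L \<ge> 0"
  obtains m0 :: nat where "\<And>(m::nat) K y. m \<ge> m0 \<Longrightarrow> int_vec K \<Longrightarrow> real m \<le> K $ 1 \<Longrightarrow> \<bar>K $ 2\<bar> \<le> L * K $ 1 \<Longrightarrow>
    \<exists>k z. int_vec k \<and> 0 < k $ 1 \<and> k $ 1 < real m \<and>
      dst z (z + k) + dst y (y + (K - k)) \<le> dst y (y + K) + \<eta> / real m"
proof -
  define C1 where "C1 = 4 * (bmax * (1 + L)) / bmin"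
  have C1: "C1 > 0"
    using bmax_pos bmin_pos assms(2) by (simp add: C1_def)
  obtain R :: nat where R: "R > 16 * bmax / \<eta>"
    using reals_Archimedean2 by blast
  have "R > 0"
    using R bmax_pos assms(1) by (metis divide_pos_pos less_trans mult_pos_pos of_nat_0_less_iff zero_less_numeral)
  define \<omega> where "\<omega> = min bmax (\<eta> / (16 * C1 * real R))"
  have \<omega>: "\<omega> > 0" "\<omega> \<le> bmax" "\<omega> \<le> \<eta> / (16 * C1 * real R)"
    using bmax_pos assms(1) C1 \<open>R > 0\<close> by (auto simp: \<omega>_def)
  obtain \<delta> where \<delta>: "\<delta> > 0" "\<And>y z. norm (z - y) < \<delta> \<Longrightarrow> \<bar>b z - b y\<bar> < \<omega>"
    using periodic2_uniformly_continuous[OF cont_b per_b \<omega>(1)] by metis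
  obtain m1 :: nat where m1: "real m1 > 2 * real R * (2 + 2 * C1) / \<delta>"
    using reals_Archimedean2 by blast
  show ?thesis
  proof
    fix m :: nat and K y :: "real^2"
    assume m: "max m1 (R + 4) \<le> m" and K: "int_vec K" "real m \<le> K $ 1" "\<bar>K $ 2\<bar> \<le> L * K $ 1"
    obtain M' where M': "K $ 1 = of_int M'"
      using K(1) by (auto simp: int_vec_def elim: Ints_cases)
    define M where "M = nat M'"
    have M: "K $ 1 = real M" "m \<le> M"
      using K(2) M' by (auto simp: M_def)
    define q where "q = m div R"
    have q: "q > 0" "q \<le> m" "q * R \<le> m"
      using m \<open>R > 0\<close> by (auto simp: q_def div_greater_zero_iff)
    have "m < q * R + R"
      using \<open>R > 0\<close> by (metis q_def add.commute dividend_less_div_times)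
    moreover have "R \<le> q * R"
      using q(1) by simp
    ultimately have "m \<le> 2 * (q * R)"
      by linarith
    then have qR: "real m \<le> 2 * (real q * real R)" "real q * real R \<le> real m"
      using q(3) by (metis of_nat_le_iff of_nat_mult of_nat_numeral)+
    have "m > 0"
      using m by linarith
    have "2 * real R * (2 + 2 * C1) < \<delta> * (2 * (real q * real R))"
    proof -
      have "2 * real R * (2 + 2 * C1) < \<delta> * real m1"
        using m1 \<delta>(1) by (simp add: field_simps)
      also have "\<dots> \<le> \<delta> * (2 * (real q * real R))"
        using \<delta>(1) m qR(1) by (intro mult_left_mono) auto
      finally show ?thesis .
    qed
    then have "2 * real R * (2 + 2 * C1) < 2 * real R * (\<delta> * real q)"
      by (simp add: algebra_simps)
    then have "(2 + 2 * C1) / real q < \<delta>"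
      using \<open>R > 0\<close> q(1) by (simp add: pos_divide_less_eq)
    then have osc: "\<bar>b w - b P\<bar> \<le> \<omega>" if "norm (w - P) \<le> (2 + 2 * C1) / real q" for w P
      using \<delta>(2)[of w P] that by auto
    obtain k z where kz: "int_vec k" "0 < k $ 1" "k $ 1 < real m"
      "dst z (z + k) + dst y (y + (K - k)) \<le>
        dst y (y + K) + 8 * bmax * real q / (real m)\<^sup>2 + 4 * \<omega> * C1 / real q"
      using loop_decomposition_step[OF K(1) M(1) _ assms(2) _ M(2) q(1,2) C1_def osc \<omega>(2)] K(3) m M(1)
      by (metis add_leD2 max.bounded_iff)
    have "8 * bmax * real q \<le> \<eta> / 2 * real m"
    proof -
      have "8 * bmax * real q \<le> (\<eta> / 2 * real R) * real q"
        using R assms(1) by (intro mult_right_mono) (auto simp: field_simps)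
      also have "\<dots> = \<eta> / 2 * (real q * real R)"
        by simp
      also have "\<dots> \<le> \<eta> / 2 * real m"
        using qR(2) assms(1) by (intro mult_left_mono) auto
      finally show ?thesis .
    qed
    then have "8 * bmax * real q / (real m)\<^sup>2 \<le> \<eta> / 2 * real m / (real m)\<^sup>2"
      by (intro divide_right_mono) auto
    then have c1: "8 * bmax * real q / (real m)\<^sup>2 \<le> \<eta> / 2 / real m"
      using \<open>m > 0\<close> by (simp add: power2_eq_square)
    have "4 * \<omega> * C1 / real q \<le> \<eta> / (4 * real R * real q)"
    proof -
      have "4 * \<omega> * C1 \<le> \<eta> / (4 * real R)"
        using \<omega>(3) C1 \<open>R > 0\<close> by (simp add: field_simps)
      then have "4 * \<omega> * C1 / real q \<le> \<eta> / (4 * real R) / real q"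
        by (intro divide_right_mono) auto
      then show ?thesis by simp
    qed
    also have "\<dots> \<le> \<eta> / (2 * real m)"
      using qR(1) assms(1) \<open>m > 0\<close> \<open>R > 0\<close> q(1) by (intro divide_left_mono) (auto simp: algebra_simps)
    finally have c2: "4 * \<omega> * C1 / real q \<le> \<eta> / 2 / real m"
      by simp
    have "\<eta> / 2 / real m + \<eta> / 2 / real m = \<eta> / real m"
      by simp
    then have "dst z (z + k) + dst y (y + (K - k)) \<le> dst y (y + K) + \<eta> / real m"
      using kz(4) c1 c2 by linarith
    then show "\<exists>k z. int_vec k \<and> 0 < k $ 1 \<and> k $ 1 < real m \<and>
        dst z (z + k) + dst y (y + (K - k)) \<le> dst y (y + K) + \<eta> / real m"
      using kz by blast
  qed
qed

end

section \<open>The effective Hamiltonian and the distance\<close>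

lemma has_real_derivative_moving_integral:
  fixes f :: "real \<Rightarrow> real"
  assumes f: "continuous_on UNIV f" and h: "h \<ge> 0"
  shows "((\<lambda>x. integral {0..h} (\<lambda>s. f (x + s))) has_real_derivative f (x + h) - f x) (at x)"
proof -
  obtain \<Phi> where "\<And>x. (\<Phi> has_vector_derivative f x) (at x)"
    using einterval_antiderivative[of "-\<infinity>" \<infinity> f] f by (auto simp: continuous_on_eq_continuous_at)
  then have \<Phi>: "(\<Phi> has_real_derivative f x) (at x)" for x
    by (simp add: has_real_derivative_iff_has_vector_derivative)
  have shift: "((\<lambda>x. \<Phi> (x + c)) has_real_derivative f (x + c)) (at x)" for x c
    using \<Phi>[of "x + c"] by (simp add: DERIV_shift)
  have "integral {0..h} (\<lambda>s. f (x + s)) = \<Phi> (x + h) - \<Phi> x" for x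
  proof (rule integral_unique)
    have "((\<lambda>s. \<Phi> (s + x)) has_vector_derivative f (x + s)) (at s within {0..h})" for s
      using shift[of x s]
      by (simp add: has_real_derivative_iff_has_vector_derivative add.commute has_vector_derivative_at_within)
    then show "((\<lambda>s. f (x + s)) has_integral \<Phi> (x + h) - \<Phi> x) {0..h}"
      using fundamental_theorem_of_calculus[OF h, of "\<lambda>s. \<Phi> (s + x)" "\<lambda>s. f (x + s)"]
      by (simp add: add.commute)
  qed
  then have "(\<lambda>x. integral {0..h} (\<lambda>s. f (x + s))) = (\<lambda>x. \<Phi> (x + h) - \<Phi> x)"
    by auto
  then show ?thesis
    using shift \<Phi> by (auto intro!: DERIV_diff)
qed

text \<open>Averaging over small squares: the partial derivatives of the average are differences of
  averages over the edges.\<close>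

lemma C1_smoothing:
  fixes u :: "real^2 \<Rightarrow> real"
  assumes u: "continuous_on UNIV u" and h: "h > 0"
  obtains v g where "continuous_on UNIV g" "\<And>y. (v has_derivative (\<lambda>x. g y \<bullet> x)) (at y)"
    "\<And>y z c. (\<And>w. norm w \<le> 2 * h \<Longrightarrow> u (z + w) - u (y + w) \<le> c) \<Longrightarrow> v z - v y \<le> c"
proof -
  define f where "f x y = u (vector [x, y])" for x y :: real
  have vec: "vector [x, y] = x *\<^sub>R axis 1 1 + y *\<^sub>R (axis 2 1 :: real^2)" for x y :: real
    by (rule real2_eqI) (auto simp: axis_def)
  have cont: "continuous_on A (\<lambda>z. f (l z) (l' z))"
    if "continuous_on A l" "continuous_on A l'" for A and l l' :: "'a::topological_space \<Rightarrow> real"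
    unfolding f_def vec by (intro continuous_on_compose2[OF u] continuous_intros that) auto
  define G where "G x y = integral {0..h} (\<lambda>t. f x (y + t))" for x y
  define H where "H x y = integral {0..h} (\<lambda>s. f (x + s) y)" for x y
  define F where "F x y = integral {0..h} (\<lambda>s. G (x + s) y)" for x y
  have contG: "continuous_on UNIV (\<lambda>z. G (fst z) (snd z))"
  proof -
    have "continuous_on (UNIV \<times> cbox 0 h) (\<lambda>(z, t). f (fst z) (snd z + t))"
      unfolding case_prod_beta' by (intro cont continuous_intros)
    from integral_continuous_on_param[OF this] show ?thesis
      by (simp add: G_def)
  qed
  have contH: "continuous_on UNIV (\<lambda>z. H (fst z) (snd z))"
  proof -
    have "continuous_on (UNIV \<times> cbox 0 h) (\<lambda>(z, t). f (fst z + t) (snd z))"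
      unfolding case_prod_beta' by (intro cont continuous_intros)
    from integral_continuous_on_param[OF this] show ?thesis
      by (simp add: H_def)
  qed
  have contG': "continuous_on A (\<lambda>z. G (l z) (l' z))"
    if "continuous_on A l" "continuous_on A l'" for A and l l' :: "'a::topological_space \<Rightarrow> real"
    using continuous_on_compose2[OF contG continuous_on_Pair[OF that]] by simp
  have contH': "continuous_on A (\<lambda>z. H (l z) (l' z))"
    if "continuous_on A l" "continuous_on A l'" for A and l l' :: "'a::topological_space \<Rightarrow> real"
    using continuous_on_compose2[OF contH continuous_on_Pair[OF that]] by simp
  \<comment> \<open>Exchanging the order of integration makes \<open>F\<close> a moving integral in
    the second variable as well.\<close>
  have F_swap: "F x y = integral {0..h} (\<lambda>t. H x (y + t))" for x y
  proof -
    have "continuous_on (cbox (0, 0) (h, h)) (\<lambda>(s, t). f (x + s) (y + t))"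
      unfolding case_prod_beta' by (intro cont continuous_intros)
    from integral_swap_continuous[OF this] show ?thesis
      by (simp add: F_def G_def H_def)
  qed
  have Fx: "((\<lambda>x. F x y) has_real_derivative G (x + h) y - G x y) (at x)" for x y
    unfolding F_def using h
    by (intro has_real_derivative_moving_integral[of "\<lambda>x. G x y"] contG' continuous_intros) auto
  have Fy: "((\<lambda>y. F x y) has_real_derivative H x (y + h) - H x y) (at y)" for x y
    unfolding F_swap using h
    by (intro has_real_derivative_moving_integral[of "\<lambda>y. H x y"] contH' continuous_intros) auto
  \<comment> \<open>Partial differentiability in both variables, with continuity of the second
    partial derivative, gives total differentiability.\<close>
  have F_deriv: "((\<lambda>(x, y). F x y) has_derivative
      (\<lambda>(tx, ty). (G (x + h) y - G x y) * tx + blinfun_apply (blinfun_mult_right (H x (y + h) - H x y)) ty))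
      (at (x, y) within UNIV \<times> UNIV)" for x y
  proof (rule has_derivative_partialsI)
    show "((\<lambda>x. F x y) has_derivative (*) (G (x + h) y - G x y)) (at x within UNIV)"
      using Fx[of y x] by (simp add: has_field_derivative_def)
    show "((\<lambda>y. F x y) has_derivative blinfun_apply (blinfun_mult_right (H x (y + h) - H x y))) (at y within UNIV)" for x y
      using Fy[of x y] by (simp add: has_field_derivative_def blinfun_mult_right.rep_eq)
    have "continuous_on UNIV (\<lambda>z. blinfun_mult_right (H (fst z) (snd z + h) - H (fst z) (snd z)))"
      by (intro bounded_linear.continuous_on[OF bounded_linear_blinfun_mult_right] contH' continuous_intros)
    then show "continuous (at (x, y) within UNIV \<times> UNIV) (\<lambda>(x, y). blinfun_mult_right (H x (y + h) - H x y))"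
      by (simp add: case_prod_beta' continuous_on_eq_continuous_at)
  qed auto
  define v where "v y = F (y $ 1) (y $ 2) / h\<^sup>2" for y :: "real^2"
  define g :: "real^2 \<Rightarrow> real^2" where
    "g y = vector [(G (y $ 1 + h) (y $ 2) - G (y $ 1) (y $ 2)) / h\<^sup>2,
                   (H (y $ 1) (y $ 2 + h) - H (y $ 1) (y $ 2)) / h\<^sup>2]" for y
  show ?thesis
  proof
    show "continuous_on UNIV g"
      unfolding g_def vec divide_inverse by (intro continuous_intros contG' contH')
    show "(v has_derivative (\<lambda>x. g y \<bullet> x)) (at y)" for y
    proof -
      have "((\<lambda>y::real^2. (y $ 1, y $ 2)) has_derivative (\<lambda>x. (x $ 1, x $ 2))) (at y)"
        by (intro has_derivative_Pair bounded_linear_imp_has_derivative bounded_linear_vec_nth)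
      from has_derivative_compose[OF this F_deriv[of "y $ 1" "y $ 2", unfolded UNIV_Times_UNIV]]
      have "((\<lambda>y. F (y $ 1) (y $ 2)) has_derivative (\<lambda>x. (G (y $ 1 + h) (y $ 2) - G (y $ 1) (y $ 2)) * x $ 1 +
          (H (y $ 1) (y $ 2 + h) - H (y $ 1) (y $ 2)) * x $ 2)) (at y)"
        by (simp add: blinfun_mult_right.rep_eq)
      then have "((\<lambda>y. F (y $ 1) (y $ 2) * (1 / h\<^sup>2)) has_derivative (\<lambda>x. ((G (y $ 1 + h) (y $ 2) - G (y $ 1) (y $ 2)) * x $ 1 +
          (H (y $ 1) (y $ 2 + h) - H (y $ 1) (y $ 2)) * x $ 2) * (1 / h\<^sup>2))) (at y)"
        by (rule has_derivative_mult_left)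
      then show ?thesis
        by (simp add: v_def[abs_def] g_def inner_real2 add_divide_distrib)
    qed
    fix y z :: "real^2" and c
    \<comment> \<open>Averaging preserves a bound on increments that holds for all simultaneous
      shifts within the square; \<open>2 * h\<close> bounds the length of these shifts.\<close>
    assume le: "\<And>w. norm w \<le> 2 * h \<Longrightarrow> u (z + w) - u (y + w) \<le> c"
    have ptw: "f (z $ 1 + s) (z $ 2 + t) \<le> f (y $ 1 + s) (y $ 2 + t) + c"
      if "s \<in> {0..h}" "t \<in> {0..h}" for s t
    proof -
      have "norm (vector [s, t] :: real^2) \<le> 2 * h"
        using norm_real2_le[of "vector [s, t]"] that by simp
      moreover have "vector [x $ 1 + s, x $ 2 + t] = x + vector [s, t]" for x :: "real^2"
        by (rule real2_eqI) auto
      ultimately show ?thesis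
        using le[of "vector [s, t]"] by (simp add: f_def)
    qed
    have edge: "G (z $ 1 + s) (z $ 2) \<le> G (y $ 1 + s) (y $ 2) + c * h" if "s \<in> {0..h}" for s
    proof -
      have "G (z $ 1 + s) (z $ 2) \<le> integral {0..h} (\<lambda>t. f (y $ 1 + s) (y $ 2 + t) + c)"
        unfolding G_def using ptw[OF that]
        by (intro integral_le integrable_continuous_interval cont continuous_intros) auto
      also have "\<dots> = G (y $ 1 + s) (y $ 2) + c * h"
        unfolding G_def using h
        by (subst integral_add) (auto intro!: integrable_continuous_interval cont continuous_intros)
      finally show ?thesis .
    qed
    have "F (z $ 1) (z $ 2) \<le> integral {0..h} (\<lambda>s. G (y $ 1 + s) (y $ 2) + c * h)"
      unfolding F_def using edge
      by (intro integral_le integrable_continuous_interval contG' continuous_intros) auto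
    also have "\<dots> = F (y $ 1) (y $ 2) + c * h * h"
      unfolding F_def using h
      by (subst integral_add) (auto intro!: integrable_continuous_interval contG' continuous_intros)
    finally have "F (z $ 1) (z $ 2) - F (y $ 1) (y $ 2) \<le> c * h\<^sup>2"
      by (simp add: power2_eq_square)
    then show "v z - v y \<le> c"
      using h by (simp add: v_def field_simps)
  qed
qed

text \<open>Testing in the direction of \<open>g\<close> itself, where Cauchy-Schwarz is an
  equality, lets a one-sided bound on \<open>v\<close> suffice.\<close>

lemma gradient_norm_le:
  fixes v :: "'a::real_inner \<Rightarrow> real"
  assumes d: "(v has_derivative (\<lambda>x. g \<bullet> x)) (at y)" and \<rho>: "\<rho> > 0" and L: "L \<ge> 0"
    and lip: "\<And>z. norm (z - y) < \<rho> \<Longrightarrow> v z - v y \<le> L * norm (z - y)"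
  shows "norm g \<le> L"
proof (rule ccontr)
  assume "\<not> norm g \<le> L"
  define e where "e = (norm g - L) / 2"
  have e: "e > 0" "norm g > 0"
    using \<open>\<not> norm g \<le> L\<close> L by (auto simp: e_def)
  obtain \<delta> where \<delta>: "\<delta> > 0" "\<And>z. norm (z - y) < \<delta> \<Longrightarrow> norm (v z - v y - g \<bullet> (z - y)) \<le> e * norm (z - y)"
    using d e(1) unfolding has_derivative_at_alt by blast
  define t where "t = min \<rho> \<delta> / (2 * norm g)"
  define z where "z = y + t *\<^sub>R g"
  have t: "t > 0"
    using e \<rho> \<delta> by (simp add: t_def)
  have n: "norm (z - y) = t * norm g"
    using t by (simp add: z_def)
  also have "\<dots> = min \<rho> \<delta> / 2"
    using e(2) by (simp add: t_def)
  finally have "norm (z - y) < \<rho>" "norm (z - y) < \<delta>"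
    using \<rho> \<delta>(1) by auto
  then have "g \<bullet> (z - y) \<le> e * norm (z - y) + L * norm (z - y)"
    using \<delta>(2)[of z] lip[of z] by (auto simp: abs_le_iff)
  moreover have "g \<bullet> (z - y) = norm g * norm (z - y)"
    unfolding n by (simp add: z_def power2_norm_eq_inner[symmetric] power2_eq_square)
  ultimately have "(norm g - e - L) * norm (z - y) \<le> 0"
    by (simp add: algebra_simps)
  moreover have "norm (z - y) > 0"
    using n t e(2) by simp
  ultimately have "norm g - e - L \<le> 0"
    by (simp add: mult_le_0_iff)
  moreover have "norm g - L = 2 * e"
    by (simp add: e_def)
  ultimately show False
    using e(1) by linarith
qed

text \<open>Periodicity passes from \<open>phi\<close> to \<open>g\<close> by uniqueness of
  derivatives; it makes the supremum in \<open>eff_H\<close> finite.\<close>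

lemma C1_torus_grad_periodic:
  assumes "C1_torus_grad phi g"
  shows "periodic2 g"
  unfolding periodic2_def
proof (intro allI impI)
  fix y k :: "real^2"
  assume k: "int_vec k"
  have deriv: "(phi has_derivative (\<lambda>h. g y \<bullet> h)) (at y)" for y
    using assms by (simp add: C1_torus_grad_def)
  have "((\<lambda>y. y + k) has_derivative (\<lambda>h. h)) (at y)"
    by (auto intro!: derivative_eq_intros)
  from has_derivative_compose[OF this deriv]
  have "((\<lambda>y. phi (y + k)) has_derivative (\<lambda>h. g (y + k) \<bullet> h)) (at y)" .
  moreover have "(\<lambda>y. phi (y + k)) = phi"
    using assms k by (auto simp: C1_torus_grad_def periodic2_def)
  ultimately have "(\<lambda>h. g (y + k) \<bullet> h) = (\<lambda>h. g y \<bullet> h)"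
    using deriv[of y] has_derivative_unique by metis
  then show "g (y + k) = g y"
    by (metis vector_eq_rdot)
qed

lemma C1_torus_grad_0: "C1_torus_grad (\<lambda>_. 0) (\<lambda>_. 0)"
  by (auto simp: C1_torus_grad_def periodic2_def)

section \<open>Duality between periodic correctors and subsolutions\<close>

context periodic_weight
begin

text \<open>With \<open>b\<close> as the reciprocal of \<open>a\<close>, the bound
  \<open>a |p + D phi| \<le> \<Lambda>\<close> says that
  \<open>(p \<bullet> y + phi y) / \<Lambda>\<close> is a subsolution.\<close>

definition Heff :: "real^2 \<Rightarrow> real" where "Heff = eff_H (\<lambda>y. 1 / b y)"

text \<open>Real \<open>SUP\<close> and \<open>INF\<close> are informative only for bounded
  families; this lemma and the next two provide the bounds.\<close>

lemma Heff_sup_bdd: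
  assumes "C1_torus_grad phi g"
  shows "bdd_above (range (\<lambda>y. 1 / b y * norm (p + g y)))"
proof -
  have "b y \<noteq> 0" for y
    using b_pos[of y] by simp
  then have "continuous_on UNIV (\<lambda>y. 1 / b y * norm (p + g y))"
    using assms cont_b by (auto simp: C1_torus_grad_def intro!: continuous_intros)
  moreover have "periodic2 (\<lambda>y. 1 / b y * norm (p + g y))"
    using C1_torus_grad_periodic[OF assms] per_b by (simp add: periodic2_def)
  ultimately obtain v where "\<And>y. 1 / b y * norm (p + g y) \<le> 1 / b v * norm (p + g v)"
    using periodic2_bounded[of "\<lambda>y. 1 / b y * norm (p + g y)"] by metis
  then show ?thesis
    by (rule bdd_aboveI2)
qed

lemma Heff_sup_nonneg:
  assumes "C1_torus_grad phi g"
  shows "0 \<le> (SUP y. 1 / b y * norm (p + g y))"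
proof -
  have "0 \<le> 1 / b 0 * norm (p + g 0)"
    using b_pos[of 0] by simp
  also have "\<dots> \<le> (SUP y. 1 / b y * norm (p + g y))"
    using Heff_sup_bdd[OF assms] by (intro cSUP_upper) auto
  finally show ?thesis .
qed

lemma Heff_bdd:
  "bdd_below ((\<lambda>g. SUP y. 1 / b y * norm (p + g y)) ` {g. \<exists>phi. C1_torus_grad phi g})"
  by (rule bdd_belowI2[of _ 0]) (use Heff_sup_nonneg in blast)

lemma Heff_nonneg: "0 \<le> Heff p"
  unfolding Heff_def eff_H_def using C1_torus_grad_0 Heff_sup_nonneg by (intro cINF_greatest) auto

text \<open>A nearly optimal corrector \<open>phi\<close> gives the subsolution
  \<open>(phi y + p \<bullet> y) / \<mu>\<close>. As \<open>phi\<close> is periodic, its increment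
  from \<open>y\<close> to \<open>y + k\<close> is \<open>(p \<bullet> k) / \<mu>\<close>.\<close>

lemma inner_le_dst:
  assumes "Heff p \<le> \<Lambda>" "\<Lambda> > 0" "int_vec k"
  shows "p \<bullet> k \<le> \<Lambda> * dst y (y + k)"
proof (rule field_le_epsilon)
  fix e :: real
  assume e: "e > 0"
  \<comment> \<open>The infimum need not be attained, so \<open>\<mu>\<close> exceeds
    \<open>\<Lambda>\<close>, by so little that the excess times the distance is at most
    \<open>e\<close>. The summand 1 keeps the denominator positive.\<close>
  define \<mu> where "\<mu> = \<Lambda> + e / (dst y (y + k) + 1)"
  have pos: "dst y (y + k) + 1 > 0"
    using dst_nonneg[of y "y + k"] by linarith
  then have \<mu>: "\<mu> > \<Lambda>" "\<mu> > 0"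
    using e assms(2) by (auto simp: \<mu>_def intro: add_pos_pos)
  have "(INF g \<in> {g. \<exists>phi. C1_torus_grad phi g}. (SUP y. 1 / b y * norm (p + g y))) < \<mu>"
    using assms(1) \<mu> by (simp add: Heff_def eff_H_def)
  then obtain phi g where g: "C1_torus_grad phi g" "(SUP y. 1 / b y * norm (p + g y)) < \<mu>"
    using cINF_less_iff[OF _ Heff_bdd] C1_torus_grad_0 by blast
  have grad: "norm (p + g y) \<le> \<mu> * b y" for y
  proof -
    have "1 / b y * norm (p + g y) \<le> \<mu>"
      using cSUP_upper[OF _ Heff_sup_bdd[OF g(1), of p], of y] g(2) by simp
    then show ?thesis
      using b_pos[of y] by (simp add: field_simps)
  qed
  define u where "u y = (phi y + p \<bullet> y) / \<mu>" for y
  have u_deriv: "(u has_derivative (\<lambda>h. (1 / \<mu>) * ((p + g y) \<bullet> h))) (at y)" for y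
  proof -
    have "(phi has_derivative (\<lambda>h. g y \<bullet> h)) (at y)"
      using g(1) by (simp add: C1_torus_grad_def)
    then have "((\<lambda>y. (1 / \<mu>) * (phi y + p \<bullet> y)) has_derivative (\<lambda>h. (1 / \<mu>) * (g y \<bullet> h + p \<bullet> h))) (at y)"
      by (intro has_derivative_mult_right has_derivative_add has_derivative_inner_right has_derivative_ident)
    then show ?thesis
      by (simp add: u_def[abs_def] inner_add_left add.commute)
  qed
  have "subsolution u"
    unfolding subsolution_def
  proof (intro allI impI)
    fix y z M
    assume M: "\<forall>w\<in>closed_segment y z. b w \<le> M"
    have "norm (u z - u y) \<le> M * norm (z - y)"
    proof (rule differentiable_bound)
      show "convex (closed_segment y z)" by simp
      show "(u has_derivative (\<lambda>h. (1 / \<mu>) * ((p + g w) \<bullet> h))) (at w within closed_segment y z)" for w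
        using u_deriv has_derivative_at_withinI by blast
      show "onorm (\<lambda>h. (1 / \<mu>) * ((p + g w) \<bullet> h)) \<le> M" if "w \<in> closed_segment y z" for w
      proof (rule onorm_bound)
        show "0 \<le> M"
          using segment_weight_pos[of y z M] M by force
        fix h
        have "norm ((p + g w) \<bullet> h) \<le> norm (p + g w) * norm h"
          by (simp add: Cauchy_Schwarz_ineq2)
        also have "\<dots> \<le> (\<mu> * M) * norm h"
          using grad[of w] M that \<mu>(2) by (intro mult_right_mono) (auto intro: order_trans)
        finally show "norm ((1 / \<mu>) * ((p + g w) \<bullet> h)) \<le> M * norm h"
          using \<mu>(2) by (simp add: field_simps)
      qed
    qed auto
    then show "u z - u y \<le> M * norm (z - y)"
      by simp
  qed
  then have "u (y + k) - u y \<le> dst y (y + k)"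
    by (rule dst_ge)
  moreover have "u (y + k) - u y = (p \<bullet> k) / \<mu>"
    using g(1) assms(3) by (simp add: u_def C1_torus_grad_def periodic2_def inner_add_right diff_divide_distrib[symmetric])
  ultimately have "(p \<bullet> k) / \<mu> \<le> dst y (y + k)"
    by simp
  then have "p \<bullet> k \<le> \<mu> * dst y (y + k)"
    using \<mu>(2) by (simp add: pos_divide_le_eq mult.commute)
  also have "\<dots> = \<Lambda> * dst y (y + k) + e * (dst y (y + k) / (dst y (y + k) + 1))"
    by (simp add: \<mu>_def algebra_simps)
  also have "\<dots> \<le> \<Lambda> * dst y (y + k) + e * 1"
    using pos e by (intro add_left_mono mult_left_mono) auto
  finally show "p \<bullet> k \<le> \<Lambda> * dst y (y + k) + e"
    by simp
qed

text \<open>The infimum of cones \<open>u\<close> is a subsolution that increases by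
  \<open>(p \<bullet> l) / \<Lambda>\<close> under translation by an integer vector
  \<open>l\<close>. Smoothing keeps these increments and raises the gradient bound only slightly, so
  \<open>\<Lambda> * v y - p \<bullet> y\<close> is a periodic corrector.\<close>

lemma Heff_le_if_inner_le_dst:
  assumes \<Lambda>: "\<Lambda> > 0" and le: "\<And>k. int_vec k \<Longrightarrow> p \<bullet> k \<le> \<Lambda> * dst 0 k"
  shows "Heff p \<le> \<Lambda>"
proof -
  define u where "u y = (INF k\<in>Collect int_vec. (p \<bullet> k) / \<Lambda> + dst k y)" for y
  have ne: "Collect int_vec \<noteq> {}"
    using int_vec_0 by blast
  \<comment> \<open>This is where the hypothesis enters, applied to \<open>- k\<close>: without it
    the infimum could be unbounded below.\<close>
  have bdd: "bdd_below ((\<lambda>k. (p \<bullet> k) / \<Lambda> + dst k y) ` Collect int_vec)" for y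
  proof (rule bdd_belowI2)
    fix k assume "k \<in> Collect int_vec"
    then have k: "int_vec (- k)"
      by (simp add: int_vec_minus)
    have "dst k 0 \<le> dst k y + dst y 0"
      by (rule dst_triangle)
    moreover have "dst k 0 = dst 0 (- k)"
      using dst_translate[OF k, of k 0] by simp
    moreover have "- (p \<bullet> k) / \<Lambda> \<le> dst 0 (- k)"
      using le[OF k] \<Lambda> by (simp add: field_simps)
    ultimately show "- dst y 0 \<le> (p \<bullet> k) / \<Lambda> + dst k y"
      by simp
  qed
  have "subsolution u"
    unfolding u_def using ne bdd by (intro subsolution_INF subsolution_add_const subsolution_dst)
  have shift_le: "u (y + l) \<le> u y + (p \<bullet> l) / \<Lambda>" if l: "int_vec l" for y l
  proof -
    have "u (y + l) - (p \<bullet> l) / \<Lambda> \<le> (INF k\<in>Collect int_vec. (p \<bullet> k) / \<Lambda> + dst k y)"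
    proof (rule cINF_greatest[OF ne])
      fix k assume k: "k \<in> Collect int_vec"
      then have "k + l \<in> Collect int_vec"
        using l by (simp add: int_vec_add)
      then have "u (y + l) \<le> (p \<bullet> (k + l)) / \<Lambda> + dst (k + l) (y + l)"
        unfolding u_def by (rule cINF_lower[OF bdd])
      then show "u (y + l) - (p \<bullet> l) / \<Lambda> \<le> (p \<bullet> k) / \<Lambda> + dst k y"
        by (simp add: inner_add_right add_divide_distrib dst_translate[OF l])
    qed
    then show ?thesis
      by (simp add: u_def)
  qed
  have shift: "u (y + l) - u y = (p \<bullet> l) / \<Lambda>" if "int_vec l" for y l
    using shift_le[OF that, of y] shift_le[OF int_vec_minus[OF that], of "y + l"] by simp
  have "Heff p \<le> \<Lambda> * (1 + e)" if e: "e > 0" for e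
  proof -
    \<comment> \<open>The factor \<open>bmin\<close> turns the additive error \<open>e'\<close> into
      the relative error \<open>e\<close>.\<close>
    define e' where "e' = e * bmin"
    have e': "e' > 0"
      using e bmin_pos by (simp add: e'_def)
    obtain \<delta> where \<delta>: "\<delta> > 0" "\<And>y z. norm (z - y) < \<delta> \<Longrightarrow> \<bar>b z - b y\<bar> < e'"
      using periodic2_uniformly_continuous[OF cont_b per_b e'] by metis
    \<comment> \<open>Averaging shifts points by at most \<open>\<delta> / 4\<close>. With
      \<open>z\<close> within \<open>\<delta> / 2\<close> of \<open>y\<close>, shifted segments stay
      in the ball of radius \<open>\<delta>\<close> around \<open>y\<close>.\<close>
    obtain v g where v: "continuous_on UNIV g" "\<And>y. (v has_derivative (\<lambda>x. g y \<bullet> x)) (at y)"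
      "\<And>y z c. (\<And>w. norm w \<le> 2 * (\<delta> / 8) \<Longrightarrow> u (z + w) - u (y + w) \<le> c) \<Longrightarrow> v z - v y \<le> c"
      using C1_smoothing[OF subsolution_continuous[OF \<open>subsolution u\<close>], of "\<delta> / 8"] \<delta>(1)
      by (metis divide_pos_pos zero_less_numeral)
    have g_le: "norm (g y) \<le> b y + e'" for y
    proof (rule gradient_norm_le[OF v(2)])
      show "\<delta> / 2 > 0" "0 \<le> b y + e'"
        using \<delta>(1) b_pos[of y] e' by auto
      fix z assume z: "norm (z - y) < \<delta> / 2"
      show "v z - v y \<le> (b y + e') * norm (z - y)"
      proof (rule v(3))
        fix w :: "real^2" assume w: "norm w \<le> 2 * (\<delta> / 8)"
        have "b x \<le> b y + e'" if "x \<in> closed_segment (y + w) (z + w)" for x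
        proof -
          have "closed_segment (y + w) (z + w) \<subseteq> ball y \<delta>"
          proof (rule closed_segment_subset)
            show "y + w \<in> ball y \<delta>"
              using w \<delta>(1) by (simp add: dist_norm)
            have "norm ((z - y) + w) < \<delta>"
              using norm_triangle_ineq[of "z - y" w] w z \<delta>(1) by simp
            then show "z + w \<in> ball y \<delta>"
              by (simp add: dist_norm norm_minus_commute algebra_simps)
          qed simp
          then have "norm (x - y) < \<delta>"
            using that by (auto simp: dist_norm norm_minus_commute)
          then show ?thesis
            using \<delta>(2)[of x y] by auto
        qed
        then show "u (z + w) - u (y + w) \<le> (b y + e') * norm (z - y)"
          using subsolutionD[OF \<open>subsolution u\<close>, of "y + w" "z + w" "b y + e'"] by simp
      qed
    qed
    have v_shift: "v (y + k) - v y = (p \<bullet> k) / \<Lambda>" if k: "int_vec k" for y k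
    proof (rule antisym)
      have eq: "u (y + k + w) - u (y + w) = (p \<bullet> k) / \<Lambda>" for w
        using shift[OF k, of "y + w"] by (simp add: ac_simps)
      show "v (y + k) - v y \<le> (p \<bullet> k) / \<Lambda>"
        using eq by (intro v(3)) simp
      have "u (y + w) - u (y + k + w) \<le> - ((p \<bullet> k) / \<Lambda>)" for w
        using eq[of w] by linarith
      then have "v y - v (y + k) \<le> - ((p \<bullet> k) / \<Lambda>)"
        by (intro v(3))
      then show "(p \<bullet> k) / \<Lambda> \<le> v (y + k) - v y"
        by simp
    qed
    have C1: "C1_torus_grad (\<lambda>y. \<Lambda> * v y - p \<bullet> y) (\<lambda>y. \<Lambda> *\<^sub>R g y - p)"
      unfolding C1_torus_grad_def periodic2_def
    proof (intro conjI allI impI)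
      fix y k :: "real^2"
      assume "int_vec k"
      then have "\<Lambda> * (v (y + k) - v y) = p \<bullet> k"
        using v_shift \<Lambda> by simp
      then show "\<Lambda> * v (y + k) - p \<bullet> (y + k) = \<Lambda> * v y - p \<bullet> y"
        by (simp add: algebra_simps)
    next
      show "continuous_on UNIV (\<lambda>y. \<Lambda> *\<^sub>R g y - p)"
        by (intro continuous_intros v(1))
      have "((\<lambda>y. \<Lambda> * v y - p \<bullet> y) has_derivative (\<lambda>h. \<Lambda> * (g y \<bullet> h) - p \<bullet> h)) (at y)" for y
        by (intro has_derivative_diff has_derivative_mult_right v(2) has_derivative_inner_right has_derivative_ident)
      then show "((\<lambda>y. \<Lambda> * v y - p \<bullet> y) has_derivative (\<lambda>h. (\<Lambda> *\<^sub>R g y - p) \<bullet> h)) (at y)" for y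
        by (simp add: inner_diff_left)
    qed
    have "Heff p \<le> (SUP y. 1 / b y * norm (p + (\<Lambda> *\<^sub>R g y - p)))"
      unfolding Heff_def eff_H_def using C1 by (intro cINF_lower[OF Heff_bdd]) blast
    also have "\<dots> \<le> \<Lambda> * (1 + e)"
    proof (rule cSUP_least)
      fix y
      have "e' \<le> e * b y"
        using bmin_le[of y] e by (simp add: e'_def)
      then have "norm (g y) \<le> b y * (1 + e)"
        using g_le[of y] by (simp add: algebra_simps)
      then have "\<Lambda> * norm (g y) \<le> \<Lambda> * (b y * (1 + e))"
        using \<Lambda> by (intro mult_left_mono) auto
      then show "1 / b y * norm (p + (\<Lambda> *\<^sub>R g y - p)) \<le> \<Lambda> * (1 + e)"
        using \<Lambda> b_pos[of y] by (simp add: field_simps)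
    qed simp
    finally show ?thesis .
  qed
  note approx = this
  show ?thesis
  proof (rule field_le_epsilon)
    fix e :: real assume "e > 0"
    moreover have "\<Lambda> * (1 + e / \<Lambda>) = \<Lambda> + e"
      using \<Lambda> by (simp add: field_simps)
    ultimately show "Heff p \<le> \<Lambda> + e"
      using approx[of "e / \<Lambda>"] \<Lambda> by simp
  qed
qed

lemma Heff_le_iff:
  assumes "\<Lambda> > 0"
  shows "Heff p \<le> \<Lambda> \<longleftrightarrow> (\<forall>k. int_vec k \<longrightarrow> p \<bullet> k \<le> \<Lambda> * dst 0 k)"
  using assms inner_le_dst[of p \<Lambda> _ 0] Heff_le_if_inner_le_dst[of \<Lambda> p] by auto

end

section \<open>Strict convexity in irrational directions\<close>

lemma irrational_slope:
  fixes e :: "real^2"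
  assumes "\<not> rational_dir e"
  shows "e $ 2 \<noteq> 0" "e $ 1 / e $ 2 \<notin> \<rat>"
proof -
  have no: "e \<noteq> c *\<^sub>R vector [of_int m, of_int n]" for c m n
    using assms int_vec_vector[of m n] unfolding rational_dir_def by blast
  show e2: "e $ 2 \<noteq> 0"
  proof
    assume "e $ 2 = 0"
    then have "e = (e $ 1) *\<^sub>R vector [of_int 1, of_int 0]"
      by (intro real2_eqI) auto
    then show False
      using no by blast
  qed
  show "e $ 1 / e $ 2 \<notin> \<rat>"
  proof
    assume "e $ 1 / e $ 2 \<in> \<rat>"
    then obtain m n where mn: "n > 0" "e $ 1 / e $ 2 = of_int m / of_int n"
      by (rule Rats_cases')
    then have "e = (e $ 2 / of_int n) *\<^sub>R vector [of_int m, of_int n]"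
      using e2 by (intro real2_eqI) (auto simp: field_simps)
    then show False
      using no by blast
  qed
qed

text \<open>The line orthogonal to \<open>k\<close> is spanned by its quarter turn \<open>l\<close>,
  which is again an integer vector.\<close>

lemma orthogonal_to_int_vec_imp_rational_dir:
  assumes "int_vec k" "k \<noteq> 0" "x \<bullet> k = 0"
  shows "rational_dir x"
proof -
  have orth: "x $ 1 * k $ 1 = x $ 2 * (- k $ 2)"
    using assms(3) by (simp add: inner_real2)
  define l :: "real^2" where "l = vector [- k $ 2, k $ 1]"
  have l: "int_vec l"
    using assms(1) by (simp add: l_def int_vec_def forall_2)
  have "\<exists>c. x = c *\<^sub>R l"
  proof (cases "k $ 1 = 0")
    case True
    then have "k $ 2 \<noteq> 0"
      using assms(2) real2_eqI[of k 0] by auto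
    then have "x = (x $ 1 / (- k $ 2)) *\<^sub>R l"
      using orth True by (intro real2_eqI) (auto simp: l_def)
    then show ?thesis ..
  next
    case False
    then have "x = (x $ 2 / k $ 1) *\<^sub>R l"
      using orth by (intro real2_eqI) (auto simp: l_def field_simps)
    then show ?thesis ..
  qed
  then show ?thesis
    using l unfolding rational_dir_def by blast
qed

context periodic_weight
begin

text \<open>Induction on the first coordinate. A loop with \<open>0 < k $ 1 < m\<close> has excess
  at least \<open>|e $ 2| / (4 * m)\<close>, because \<open>m\<close> bounds the rational
  approximations from below. Splitting it off costs at most half of that, so a net gain remains for
  fewer than \<open>m\<close> units of the first coordinate.\<close>

lemma loop_excess:
  assumes p0: "\<And>k y. int_vec k \<Longrightarrow> p0 \<bullet> k \<le> dst y (y + k)"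
    and p1: "\<And>k y. int_vec k \<Longrightarrow> p1 \<bullet> k \<le> dst y (y + k)"
    and irr: "\<not> rational_dir (p1 - p0)"
  shows "\<exists>\<kappa>>0. \<forall>K y. int_vec K \<longrightarrow> K $ 1 \<ge> 0 \<longrightarrow> midpoint p0 p1 \<bullet> K + \<kappa> * K $ 1 \<le> dst y (y + K)"
proof -
  define e where "e = p1 - p0"
  define p where "p = midpoint p0 p1"
  \<comment> \<open>The maximum of two numbers is their mean plus half their distance.\<close>
  have two: "p \<bullet> K + \<bar>e \<bullet> K\<bar> / 2 \<le> dst y (y + K)" if "int_vec K" for K y
    using p0[OF that, of y] p1[OF that, of y]
    by (simp add: p_def e_def midpoint_def inner_add_left inner_diff_left abs_if field_simps)
  have e2: "\<bar>e $ 2\<bar> > 0" and \<theta>: "e $ 1 / e $ 2 \<notin> \<rat>"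
    using irrational_slope[OF irr] by (auto simp: e_def)
  \<comment> \<open>With this \<open>L\<close>, every \<open>K\<close> steeper than the cone
    satisfies \<open>|e \<bullet> K| \<ge> K $ 1\<close>.\<close>
  define L where "L = (\<bar>e $ 1\<bar> + 1) / \<bar>e $ 2\<bar>"
  have "L \<ge> 0" "\<bar>e $ 2\<bar> / 8 > 0"
    using e2 by (auto simp: L_def)
  then obtain m0 :: nat where m0: "\<And>(m::nat) K y. m \<ge> m0 \<Longrightarrow> int_vec K \<Longrightarrow> real m \<le> K $ 1 \<Longrightarrow>
      \<bar>K $ 2\<bar> \<le> L * K $ 1 \<Longrightarrow> \<exists>k z. int_vec k \<and> 0 < k $ 1 \<and> k $ 1 < real m \<and>
      dst z (z + k) + dst y (y + (K - k)) \<le> dst y (y + K) + \<bar>e $ 2\<bar> / 8 / real m"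
    using loop_decomposition by metis
  obtain m where m: "m \<ge> m0" "m > 0"
    "\<And>(j::nat) c::int. 0 < j \<Longrightarrow> j < m \<Longrightarrow> 1 / (2 * real m) \<le> \<bar>real j * (e $ 1 / e $ 2) - of_int c\<bar>"
    using badly_approximated_below[OF \<theta>, of m0] by metis
  have nat_coord: "\<exists>j. k $ 1 = real j" if "int_vec k" "k $ 1 \<ge> 0" for k
    using that by (metis Ints_cases int_vec_def of_int_0_le_iff of_nat_nat of_int_of_nat_eq)
  have short: "p \<bullet> k + \<bar>e $ 2\<bar> / (4 * real m) \<le> dst y (y + k)"
    if k: "int_vec k" "0 < k $ 1" "k $ 1 < real m" for k y
  proof -
    obtain j where j: "k $ 1 = real j"
      using nat_coord k by force
    obtain c where c: "k $ 2 = of_int c"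
      using k(1) by (auto simp: int_vec_def elim: Ints_cases)
    have "e \<bullet> k = e $ 2 * (real j * (e $ 1 / e $ 2) - of_int (- c))"
      using e2 by (simp add: inner_real2 j c field_simps)
    then have "\<bar>e \<bullet> k\<bar> = \<bar>e $ 2\<bar> * \<bar>real j * (e $ 1 / e $ 2) - of_int (- c)\<bar>"
      by (metis abs_mult)
    also have "\<dots> \<ge> \<bar>e $ 2\<bar> * (1 / (2 * real m))"
      using m(3)[of j "- c"] k j by (intro mult_left_mono) auto
    finally show ?thesis
      using two[OF k(1), of y] by simp
  qed
  \<comment> \<open>The bound \<open>1 / 2\<close> serves steep loops; the other one makes the
    required excess at most \<open>|e $ 2| / (8 * m)\<close> up to first coordinate
    \<open>m\<close>.\<close>
  define \<kappa> where "\<kappa> = min (1 / 2) (\<bar>e $ 2\<bar> / (8 * real m) / real m)"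
  have \<kappa>: "\<kappa> > 0" "\<kappa> \<le> 1 / 2"
    using e2 m(2) by (auto simp: \<kappa>_def)
  have \<kappa>m: "\<kappa> * t \<le> \<bar>e $ 2\<bar> / (8 * real m)" if "0 \<le> t" "t \<le> real m" for t
  proof -
    have "\<kappa> * t \<le> (\<bar>e $ 2\<bar> / (8 * real m) / real m) * real m"
      using that \<kappa> by (intro mult_mono) (auto simp: \<kappa>_def)
    then show ?thesis
      using m(2) by simp
  qed
  have claim: "p \<bullet> K + \<kappa> * real n \<le> dst y (y + K)" if "int_vec K" "K $ 1 = real n" for n K y
    using that
  proof (induction n arbitrary: K y rule: less_induct)
    case (less n)
    note K = less.prems
    consider "n = 0" | "L * real n < \<bar>K $ 2\<bar>" | "0 < n" "n < m" | "m \<le> n" "\<bar>K $ 2\<bar> \<le> L * real n"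
      by linarith
    then show ?case
    proof cases
      case 1
      then show ?thesis
        using two[OF K(1), of y] by auto
    next
      case 2
      \<comment> \<open>The remainder of a split may leave the cone where loops can be split; there
        the term \<open>|e \<bullet> K|\<close> alone is large enough.\<close>
      have "real n \<le> \<bar>e \<bullet> K\<bar>"
      proof -
        have "\<bar>e $ 2\<bar> * (L * real n) \<le> \<bar>e $ 2\<bar> * \<bar>K $ 2\<bar>"
          using 2 by (intro mult_left_mono) auto
        then have "(\<bar>e $ 1\<bar> + 1) * real n \<le> \<bar>e $ 2 * K $ 2\<bar>"
          using e2 by (simp add: L_def abs_mult)
        moreover have "\<bar>e $ 1 * K $ 1\<bar> = \<bar>e $ 1\<bar> * real n"
          by (simp add: K(2) abs_mult)
        ultimately show ?thesis
          by (simp add: inner_real2 algebra_simps)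
      qed
      moreover have "\<kappa> * real n \<le> 1 / 2 * real n"
        using \<kappa> by (intro mult_right_mono) auto
      ultimately show ?thesis
        using two[OF K(1), of y] by linarith
    next
      case 3
      have "\<bar>e $ 2\<bar> / (8 * real m) \<le> \<bar>e $ 2\<bar> / (4 * real m)"
        using m(2) by (intro divide_left_mono) auto
      then show ?thesis
        using short[OF K(1), of y] \<kappa>m[of "real n"] K(2) 3 by simp
    next
      case 4
      then obtain k z where k: "int_vec k" "0 < k $ 1" "k $ 1 < real m"
        "dst z (z + k) + dst y (y + (K - k)) \<le> dst y (y + K) + \<bar>e $ 2\<bar> / 8 / real m"
        using m0[OF m(1) K(1), of y] K(2) by auto
      obtain j where j: "k $ 1 = real j"
        using nat_coord k by force
      have "p \<bullet> (K - k) + \<kappa> * real (n - j) \<le> dst y (y + (K - k))"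
        using k j K 4 by (intro less.IH int_vec_diff) (auto simp: of_nat_diff)
      moreover have "real (n - j) = real n - real j"
        using k(3) j 4 by (simp add: of_nat_diff)
      ultimately have "p \<bullet> K - p \<bullet> k + \<kappa> * real n - \<kappa> * real j \<le> dst y (y + (K - k))"
        by (simp add: inner_diff_right algebra_simps)
      moreover have "\<bar>e $ 2\<bar> / (4 * real m) = 2 * (\<bar>e $ 2\<bar> / (8 * real m))" "\<bar>e $ 2\<bar> / 8 / real m = \<bar>e $ 2\<bar> / (8 * real m)"
        by auto
      ultimately show ?thesis
        using short[OF k(1-3), of z] \<kappa>m[of "real j"] k(2-4) j by linarith
    qed
  qed
  show ?thesis
    unfolding p_def[symmetric] using \<kappa>(1) claim nat_coord by metis
qed

text \<open>The excess over \<open>p \<bullet> K\<close> controls both \<open>K $ 1\<close>, by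
  \<open>loop_excess\<close>, and \<open>e \<bullet> K\<close>. Since \<open>e $ 2\<close> is
  nonzero, it controls \<open>norm K\<close>, hence a fixed fraction of the distance.\<close>

lemma Heff_midpoint_less:
  assumes "Heff p0 \<le> 1" "Heff p1 \<le> 1" and irr: "\<not> rational_dir (p1 - p0)"
  shows "Heff (midpoint p0 p1) < 1"
proof -
  define e where "e = p1 - p0"
  define p where "p = midpoint p0 p1"
  have le: "q \<bullet> k \<le> dst y (y + k)" if "Heff q \<le> 1" "int_vec k" for q k y
    using inner_le_dst[OF that(1) _ that(2), of y] by simp
  have le_minus: "(- q) \<bullet> k \<le> dst y (y + k)" if "Heff q \<le> 1" "int_vec k" for q k y
    using le[OF that(1) int_vec_minus[OF that(2)], of "y + k"] by (simp add: dst_commute)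
  obtain \<kappa>1 where \<kappa>1: "\<kappa>1 > 0"
    "\<And>K y. int_vec K \<Longrightarrow> K $ 1 \<ge> 0 \<Longrightarrow> midpoint p0 p1 \<bullet> K + \<kappa>1 * K $ 1 \<le> dst y (y + K)"
    using loop_excess[of p0 p1] le assms by metis
  \<comment> \<open>Classes with negative first coordinate are reversed: by symmetry of
    \<open>dst\<close> the negated end points satisfy the same bounds, and their difference is
    unchanged.\<close>
  have "\<not> rational_dir (- p0 - - p1)"
    using irr by simp
  then obtain \<kappa>2 where \<kappa>2: "\<kappa>2 > 0"
    "\<And>K y. int_vec K \<Longrightarrow> K $ 1 \<ge> 0 \<Longrightarrow> midpoint (- p1) (- p0) \<bullet> K + \<kappa>2 * K $ 1 \<le> dst y (y + K)"
    using loop_excess[of "- p1" "- p0"] le_minus assms by metis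
  have mid_minus: "midpoint (- p1) (- p0) = - p"
    by (simp add: p_def midpoint_def algebra_simps)
  define \<kappa> where "\<kappa> = min \<kappa>1 \<kappa>2"
  have \<kappa>: "\<kappa> > 0"
    using \<kappa>1(1) \<kappa>2(1) by (simp add: \<kappa>_def)
  have ex1: "p \<bullet> K + \<kappa> * \<bar>K $ 1\<bar> \<le> dst 0 K" if K: "int_vec K" for K
  proof (cases "K $ 1 \<ge> 0")
    case True
    have "\<kappa> * K $ 1 \<le> \<kappa>1 * K $ 1"
      using True by (intro mult_right_mono) (auto simp: \<kappa>_def)
    then show ?thesis
      using \<kappa>1(2)[OF K True, of 0] True by (simp add: p_def)
  next
    case False
    have "\<kappa>2 * K $ 1 \<le> \<kappa> * K $ 1"
      using False by (intro mult_right_mono_neg) (auto simp: \<kappa>_def)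
    moreover have "p \<bullet> K - \<kappa>2 * K $ 1 \<le> dst 0 K"
      using \<kappa>2(2)[OF int_vec_minus[OF K], of K] False by (simp add: mid_minus dst_commute[of K])
    moreover have "\<kappa> * \<bar>K $ 1\<bar> = - (\<kappa> * K $ 1)"
      using False by simp
    ultimately show ?thesis
      by linarith
  qed
  have ex2: "p \<bullet> K + \<bar>e \<bullet> K\<bar> / 2 \<le> dst 0 K" if "int_vec K" for K
    using le[OF assms(1) that, of 0] le[OF assms(2) that, of 0]
    by (simp add: p_def e_def midpoint_def inner_add_left inner_diff_left abs_if field_simps)
  have e2: "\<bar>e $ 2\<bar> > 0"
    using irrational_slope(1)[OF irr] by (simp add: e_def)
  define Q where "Q = (1 + \<bar>e $ 1\<bar> / \<bar>e $ 2\<bar>) / \<kappa> + 2 / \<bar>e $ 2\<bar>"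
  have "(1 + \<bar>e $ 1\<bar> / \<bar>e $ 2\<bar>) / \<kappa> > 0"
    using e2 \<kappa> by (intro divide_pos_pos add_pos_nonneg) auto
  then have Q: "Q > 0"
    using e2 by (simp add: Q_def add_pos_pos)
  have "norm K \<le> Q * (dst 0 K - p \<bullet> K)" if K: "int_vec K" for K
  proof -
    define D where "D = dst 0 K - p \<bullet> K"
    have D1: "\<bar>K $ 1\<bar> \<le> D / \<kappa>"
      using ex1[OF K] \<kappa> by (simp add: D_def field_simps)
    have D2: "\<bar>e \<bullet> K\<bar> \<le> 2 * D"
      using ex2[OF K] by (simp add: D_def)
    have "\<bar>e $ 2\<bar> * \<bar>K $ 2\<bar> = \<bar>e \<bullet> K - e $ 1 * K $ 1\<bar>"
      by (simp add: inner_real2 abs_mult)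
    also have "\<dots> \<le> 2 * D + \<bar>e $ 1\<bar> * \<bar>K $ 1\<bar>"
      using D2 abs_triangle_ineq4[of "e \<bullet> K" "e $ 1 * K $ 1"] by (simp add: abs_mult)
    finally have "\<bar>K $ 2\<bar> \<le> (2 * D + \<bar>e $ 1\<bar> * \<bar>K $ 1\<bar>) / \<bar>e $ 2\<bar>"
      using e2 by (simp add: field_simps)
    then have "norm K \<le> (1 + \<bar>e $ 1\<bar> / \<bar>e $ 2\<bar>) * \<bar>K $ 1\<bar> + 2 / \<bar>e $ 2\<bar> * D"
      using norm_real2_le[of K] by (simp add: algebra_simps add_divide_distrib)
    also have "\<dots> \<le> (1 + \<bar>e $ 1\<bar> / \<bar>e $ 2\<bar>) * (D / \<kappa>) + 2 / \<bar>e $ 2\<bar> * D"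
      using D1 by (intro add_right_mono mult_left_mono) auto
    also have "\<dots> = Q * D"
    proof -
      have "A * (D / \<kappa>) + t * D = (A / \<kappa> + t) * D" for A t
        by (simp add: algebra_simps)
      then show ?thesis
        unfolding Q_def .
    qed
    finally show ?thesis
      by (simp add: D_def)
  qed
  then have "bmax * norm K \<le> bmax * (Q * (dst 0 K - p \<bullet> K))" if "int_vec K" for K
    using bmax_pos that by simp
  then have Q_le: "dst 0 K \<le> (bmax * Q) * (dst 0 K - p \<bullet> K)" if "int_vec K" for K
    using dst_le_bmax[of 0 K] that by (simp add: mult.assoc) (metis order_trans)
  have gain: "p \<bullet> K \<le> (1 - 1 / (bmax * Q)) * dst 0 K" if "int_vec K" for K
  proof -
    note Q_le[OF that]
    then have "dst 0 K / (bmax * Q) \<le> dst 0 K - p \<bullet> K"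
      using Q bmax_pos by (simp add: pos_divide_le_eq mult.commute)
    then show ?thesis
      by (simp add: left_diff_distrib)
  qed
  \<comment> \<open>The maximum with \<open>1 / 2\<close> keeps \<open>\<Lambda>\<close> positive,
    as \<open>Heff_le_if_inner_le_dst\<close> requires.\<close>
  define \<Lambda> where "\<Lambda> = max (1 / 2) (1 - 1 / (bmax * Q))"
  have "Heff p \<le> \<Lambda>"
  proof (rule Heff_le_if_inner_le_dst)
    show "\<Lambda> > 0"
      by (simp add: \<Lambda>_def)
    show "p \<bullet> k \<le> \<Lambda> * dst 0 k" if "int_vec k" for k
    proof -
      have "(1 - 1 / (bmax * Q)) * dst 0 k \<le> \<Lambda> * dst 0 k"
        using dst_nonneg[of 0 k] by (intro mult_right_mono) (auto simp: \<Lambda>_def)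
      then show ?thesis
        using gain[OF that] by linarith
    qed
  qed
  also have "\<Lambda> < 1"
    using Q bmax_pos by (simp add: \<Lambda>_def)
  finally show ?thesis
    by (simp add: p_def)
qed

section \<open>The unit ball of the effective Hamiltonian and its polar, the front\<close>

lemma Heff_ball_eq: "{p. Heff p \<le> 1} = (\<Inter>k\<in>Collect int_vec. {p. k \<bullet> p \<le> dst 0 k})"
  using Heff_le_iff[of 1] by (auto simp: inner_commute)

lemma convex_Heff_ball: "convex {p. Heff p \<le> 1}"
  unfolding Heff_ball_eq by (intro convex_INT convex_halfspace_le)

lemma closed_Heff_ball: "closed {p. Heff p \<le> 1}"
  unfolding Heff_ball_eq by (intro closed_INT ballI closed_halfspace_le)

text \<open>The slack \<open>(1 - \<Lambda>) * dst 0 k\<close> grows at least like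
  \<open>bmin * (1 - \<Lambda>) * norm k\<close>, which absorbs a small change of \<open>p\<close>
  for all \<open>k\<close> at once.\<close>

lemma Heff_less_1_imp_interior:
  assumes "Heff p < 1"
  shows "p \<in> interior {p. Heff p \<le> 1}"
proof -
  define \<Lambda> where "\<Lambda> = max (1 / 2) (Heff p)"
  have \<Lambda>: "0 < \<Lambda>" "Heff p \<le> \<Lambda>" "\<Lambda> < 1"
    using assms by (auto simp: \<Lambda>_def)
  have "q \<in> {p. Heff p \<le> 1}" if "q \<in> ball p (bmin * (1 - \<Lambda>))" for q
  proof -
    have "q \<bullet> k \<le> 1 * dst 0 k" if k: "int_vec k" for k
    proof -
      have "(q - p) \<bullet> k \<le> norm (q - p) * norm k"
        by (rule norm_cauchy_schwarz)
      also have "\<dots> \<le> (bmin * (1 - \<Lambda>)) * norm k"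
        using \<open>q \<in> ball p _\<close> by (intro mult_right_mono) (auto simp: dist_norm norm_minus_commute)
      also have "\<dots> \<le> (1 - \<Lambda>) * dst 0 k"
        using mult_left_mono[OF dst_ge_bmin[of k 0], of "1 - \<Lambda>"] \<Lambda>(3) by (simp add: mult_ac)
      finally have "(q - p) \<bullet> k \<le> (1 - \<Lambda>) * dst 0 k" .
      moreover have "p \<bullet> k \<le> \<Lambda> * dst 0 k"
        using \<Lambda> k Heff_le_iff by blast
      ultimately show ?thesis
        by (simp add: inner_diff_left algebra_simps)
    qed
    then show ?thesis
      using Heff_le_if_inner_le_dst[of 1 q] by simp
  qed
  moreover have "bmin * (1 - \<Lambda>) > 0"
    using bmin_pos \<Lambda>(3) by simp
  ultimately show ?thesis
    unfolding mem_interior by blast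
qed

lemma Heff_0: "Heff 0 = 0"
proof (rule antisym[OF _ Heff_nonneg], rule field_le_epsilon)
  fix e :: real assume "e > 0"
  then show "Heff 0 \<le> 0 + e"
    using dst_nonneg by (intro Heff_le_if_inner_le_dst) auto
qed

lemma Heff_scale_le:
  assumes "c > 0"
  shows "Heff (c *\<^sub>R p) \<le> c * Heff p"
proof (rule field_le_epsilon)
  fix e :: real assume e: "e > 0"
  define \<Lambda> where "\<Lambda> = Heff p + e / c"
  have \<Lambda>: "\<Lambda> > 0" "Heff p \<le> \<Lambda>"
    using Heff_nonneg[of p] e assms by (auto simp: \<Lambda>_def add_nonneg_pos)
  have "Heff (c *\<^sub>R p) \<le> c * \<Lambda>"
  proof (rule Heff_le_if_inner_le_dst)
    show "c * \<Lambda> > 0"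
      using \<Lambda> assms by simp
    fix k assume "int_vec k"
    then have "p \<bullet> k \<le> \<Lambda> * dst 0 k"
      using \<Lambda> Heff_le_iff by blast
    then show "(c *\<^sub>R p) \<bullet> k \<le> c * \<Lambda> * dst 0 k"
      using assms by (simp add: mult.assoc)
  qed
  also have "\<dots> = c * Heff p + e"
    using assms by (simp add: \<Lambda>_def field_simps)
  finally show "Heff (c *\<^sub>R p) \<le> c * Heff p + e" .
qed

lemma Heff_scale:
  assumes "c > 0"
  shows "Heff (c *\<^sub>R p) = c * Heff p"
proof (rule antisym[OF Heff_scale_le[OF assms]])
  have "Heff ((1 / c) *\<^sub>R (c *\<^sub>R p)) \<le> (1 / c) * Heff (c *\<^sub>R p)"
    using assms by (intro Heff_scale_le) simp
  then show "c * Heff p \<le> Heff (c *\<^sub>R p)"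
    using assms by (simp add: field_simps)
qed

text \<open>Testing with the positive and negative unit vectors, whose distance from 0 is at most
  \<open>bmax\<close>, bounds each coordinate.\<close>

lemma norm_le_Heff: "norm p \<le> 2 * bmax * Heff p"
proof -
  have coord: "\<bar>p $ i\<bar> \<le> bmax * Heff p" for i
  proof (rule field_le_epsilon)
    fix e :: real assume e: "e > 0"
    define \<Lambda> where "\<Lambda> = Heff p + e / bmax"
    have \<Lambda>: "\<Lambda> > 0" "Heff p \<le> \<Lambda>"
      using Heff_nonneg[of p] e bmax_pos by (auto simp: \<Lambda>_def add_nonneg_pos)
    have ax: "p \<bullet> k \<le> \<Lambda> * bmax" if "int_vec k" "norm k = 1" for k
    proof -
      have "p \<bullet> k \<le> \<Lambda> * dst 0 k"
        using that(1) \<Lambda> Heff_le_iff by blast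
      also have "\<dots> \<le> \<Lambda> * bmax"
        using \<Lambda>(1) dst_le_bmax[of 0 k] that(2) by (intro mult_left_mono) auto
      finally show ?thesis .
    qed
    have axis: "int_vec (axis i 1)"
      by (simp add: int_vec_def axis_def)
    have "\<bar>p $ i\<bar> \<le> \<Lambda> * bmax"
      using ax[OF axis] ax[OF int_vec_minus[OF axis]] by (simp add: inner_axis abs_le_iff)
    also have "\<dots> = bmax * Heff p + e"
      using bmax_pos by (simp add: \<Lambda>_def distrib_right)
    finally show "\<bar>p $ i\<bar> \<le> bmax * Heff p + e" .
  qed
  show ?thesis
    using norm_real2_le[of p] coord[of 1] coord[of 2] by linarith
qed

lemma Heff_pos: "p \<noteq> 0 \<Longrightarrow> Heff p > 0"
  using norm_le_Heff[of p] Heff_nonneg[of p] by (smt (verit) mult_eq_0_iff norm_eq_zero norm_ge_zero)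

text \<open>As \<open>Heff 0 = 0\<close>, this is the subdifferential at 0; by homogeneity it is
  also the polar of the unit ball of \<open>Heff\<close>.\<close>

definition front :: "(real^2) set" where "front = {x. \<forall>p. x \<bullet> p \<le> Heff p}"

lemma front_eq: "front = (\<Inter>p. {x. p \<bullet> x \<le> Heff p})"
  by (auto simp: front_def inner_commute)

lemma convex_front: "convex front"
  unfolding front_eq by (intro convex_INT convex_halfspace_le)

lemma closed_front: "closed front"
  unfolding front_eq by (intro closed_INT ballI closed_halfspace_le)

lemma interior_front_nonempty: "interior front \<noteq> {}"
proof -
  define r where "r = 1 / (2 * bmax)"
  have r: "r > 0"
    using bmax_pos by (simp add: r_def)
  have "x \<in> front" if "x \<in> ball 0 r" for x
  proof -
    have "x \<bullet> p \<le> Heff p" for p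
    proof -
      have "x \<bullet> p \<le> norm x * norm p"
        by (rule norm_cauchy_schwarz)
      also have "\<dots> \<le> r * (2 * bmax * Heff p)"
        using that norm_le_Heff[of p] r by (intro mult_mono) auto
      also have "\<dots> = Heff p"
        using bmax_pos by (simp add: r_def)
      finally show ?thesis .
    qed
    then show ?thesis
      by (simp add: front_def)
  qed
  then have "0 \<in> interior front"
    using r unfolding mem_interior by blast
  then show ?thesis
    by blast
qed

text \<open>An instance of bipolarity: the normal of a supporting line of the unit ball at
  \<open>q / Heff q\<close>, rescaled to have product 1 with this point, lies in the front.\<close>

lemma support_function_front:
  assumes "q \<noteq> 0"
  shows "\<exists>y\<in>front. q \<bullet> y = Heff q"
proof -
  define S where "S = {p. Heff p \<le> 1}"
  define q' where "q' = (1 / Heff q) *\<^sub>R q"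
  have Hq: "Heff q > 0"
    using assms by (rule Heff_pos)
  then have Hq': "Heff q' = 1"
    by (simp add: q'_def Heff_scale)
  have int0: "0 \<in> interior S"
    unfolding S_def by (intro Heff_less_1_imp_interior) (simp add: Heff_0)
  then have rel: "rel_interior S = interior S"
    by (intro rel_interior_nonempty_interior) blast
  have "q' \<notin> interior S"
  proof
    assume "q' \<in> interior S"
    then obtain \<epsilon> where \<epsilon>: "\<epsilon> > 0" "ball q' \<epsilon> \<subseteq> S"
      by (auto simp: mem_interior)
    have nq: "norm q' > 0"
      using Hq' Heff_0 by auto
    define t where "t = \<epsilon> / (2 * norm q')"
    have t: "t > 0"
      using \<epsilon>(1) nq by (simp add: t_def)
    have "dist q' ((1 + t) *\<^sub>R q') = t * norm q'"
      using t by (simp add: dist_norm scaleR_add_left)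
    also have "\<dots> < \<epsilon>"
      using \<epsilon>(1) nq by (simp add: t_def)
    finally have "Heff ((1 + t) *\<^sub>R q') \<le> 1"
      using \<epsilon>(2) by (auto simp: S_def)
    then show False
      using t Hq' by (simp add: Heff_scale)
  qed
  moreover have "q' \<in> S"
    using Hq' by (simp add: S_def)
  moreover have "convex S"
    unfolding S_def by (rule convex_Heff_ball)
  ultimately obtain a where a: "\<And>y. y \<in> S \<Longrightarrow> a \<bullet> q' \<le> a \<bullet> y" "\<And>y. y \<in> rel_interior S \<Longrightarrow> a \<bullet> q' < a \<bullet> y"
    using supporting_hyperplane_rel_boundary[of S q'] rel by metis
  \<comment> \<open>The origin is interior, so it lies strictly on the far side of the supporting
    line. Dividing by the negative number \<open>a \<bullet> q'\<close> reverses the inequality to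
    \<open>y \<bullet> p \<le> 1\<close>.\<close>
  have neg: "a \<bullet> q' < 0"
    using a(2)[of 0] int0 rel by simp
  define y where "y = (1 / (a \<bullet> q')) *\<^sub>R a"
  have y_le: "y \<bullet> p \<le> 1" if "p \<in> S" for p
    using a(1)[OF that] neg by (simp add: y_def divide_le_eq)
  have yq': "y \<bullet> q' = 1"
    using neg by (simp add: y_def)
  have "y \<bullet> p \<le> Heff p" for p
  proof (cases "p = 0")
    case True
    then show ?thesis
      by (simp add: Heff_0)
  next
    case False
    then have Hp: "Heff p > 0"
      by (rule Heff_pos)
    then have "(1 / Heff p) *\<^sub>R p \<in> S"
      by (simp add: S_def Heff_scale)
    from y_le[OF this] show ?thesis
      using Hp by (simp add: field_simps)
  qed
  then have "y \<in> front"
    by (simp add: front_def)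
  moreover have "q \<bullet> y = Heff q"
    using yq' Hq by (simp add: q'_def inner_commute field_simps)
  ultimately show ?thesis
    by blast
qed

lemma unit_ball_no_irrational_segment:
  assumes "\<not> rational_dir (v - u)"
  shows "\<not> closed_segment u v \<subseteq> frontier {p. Heff p \<le> 1}"
proof
  assume segment: "closed_segment u v \<subseteq> frontier {p. Heff p \<le> 1}"
  then have "u \<in> {p. Heff p \<le> 1}" "v \<in> {p. Heff p \<le> 1}"
    using frontier_subset_closed[OF closed_Heff_ball] by auto
  then have "Heff (midpoint u v) < 1"
    using Heff_midpoint_less assms by simp
  then have "midpoint u v \<in> interior {p. Heff p \<le> 1}"
    by (rule Heff_less_1_imp_interior)
  then show False
    using segment midpoints_in_convex_hull[of u "{u, v}" v]
    by (auto simp: frontier_def segment_convex_hull hull_inc)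
qed

text \<open>Normals at \<open>x\<close>, scaled to \<open>Heff = 1\<close>, have product 1 with
  \<open>x\<close>. Two distinct ones would differ by a vector orthogonal to \<open>x\<close>, hence
  irrational; their midpoint would have \<open>Heff < 1\<close> but product 1 with \<open>x\<close>,
  against \<open>x \<in> front\<close>.\<close>

lemma front_unique_normal:
  assumes x: "x \<in> frontier front" and irr: "\<not> rational_dir x"
  shows "\<exists>n. n \<noteq> 0 \<and> (\<forall>q. q \<noteq> 0 \<and> (\<forall>y\<in>front. q \<bullet> y \<le> q \<bullet> x) \<longleftrightarrow> (\<exists>c>0. q = c *\<^sub>R n))"
proof -
  have x_front: "x \<in> front"
    using x frontier_subset_closed[OF closed_front] by blast
  have "x \<notin> rel_interior front"
    using x rel_interior_nonempty_interior[OF interior_front_nonempty] by (simp add: frontier_def)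
  then obtain a where a: "a \<noteq> 0" "\<And>y. y \<in> front \<Longrightarrow> a \<bullet> x \<le> a \<bullet> y"
    using supporting_hyperplane_rel_boundary[OF convex_front x_front] by metis
  define n where "n = - a"
  have n: "n \<noteq> 0" "\<forall>y\<in>front. n \<bullet> y \<le> n \<bullet> x"
    using a by (auto simp: n_def)
  \<comment> \<open>\<open>Heff\<close> is the support function of the front, and a normal direction
    at \<open>x\<close> attains it at \<open>x\<close>.\<close>
  have support: "Heff q = q \<bullet> x" if q: "q \<noteq> 0" "\<forall>y\<in>front. q \<bullet> y \<le> q \<bullet> x" for q
  proof -
    have "Heff q \<le> q \<bullet> x"
      using support_function_front[OF q(1)] q(2) by force
    then show ?thesis
      using x_front by (auto simp: front_def inner_commute intro: antisym)
  qed
  have "\<exists>c>0. q = c *\<^sub>R n" if q: "q \<noteq> 0" "\<forall>y\<in>front. q \<bullet> y \<le> q \<bullet> x" for q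
  proof -
    define q1 where "q1 = (1 / Heff q) *\<^sub>R q"
    define n1 where "n1 = (1 / Heff n) *\<^sub>R n"
    have pos: "Heff q > 0" "Heff n > 0"
      using Heff_pos q n by auto
    have H1: "Heff q1 \<le> 1" "Heff n1 \<le> 1"
      using pos by (auto simp: q1_def n1_def Heff_scale)
    have x1: "q1 \<bullet> x = 1" "n1 \<bullet> x = 1"
      using pos support[OF q] support[OF n] by (auto simp: q1_def n1_def)
    have "q1 = n1"
    proof (rule ccontr)
      assume "q1 \<noteq> n1"
      have "\<not> rational_dir (q1 - n1)"
      proof
        assume "rational_dir (q1 - n1)"
        then obtain c k where ck: "int_vec k" "q1 - n1 = c *\<^sub>R k"
          unfolding rational_dir_def by blast
        then have "k \<noteq> 0" "c \<noteq> 0"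
          using \<open>q1 \<noteq> n1\<close> by auto
        have "c * (x \<bullet> k) = (q1 - n1) \<bullet> x"
          unfolding ck(2) by (simp add: inner_commute)
        also have "\<dots> = 0"
          using x1 by (simp add: inner_diff_left)
        finally have "x \<bullet> k = 0"
          using \<open>c \<noteq> 0\<close> by simp
        then show False
          using orthogonal_to_int_vec_imp_rational_dir[OF ck(1) \<open>k \<noteq> 0\<close>] irr by blast
      qed
      then have "Heff (midpoint n1 q1) < 1"
        by (rule Heff_midpoint_less[OF H1(2,1)])
      moreover have "x \<bullet> midpoint n1 q1 = 1"
        using x1 by (simp add: midpoint_def inner_add_right inner_commute)
      moreover have "x \<bullet> midpoint n1 q1 \<le> Heff (midpoint n1 q1)"
        using x_front by (simp add: front_def)
      ultimately show False
        by linarith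
    qed
    moreover have "q = Heff q *\<^sub>R q1"
      using pos by (simp add: q1_def)
    ultimately have "q = (Heff q / Heff n) *\<^sub>R n"
      by (simp add: n1_def)
    then show ?thesis
      using pos by (intro exI[of _ "Heff q / Heff n"]) auto
  qed
  moreover have "q \<noteq> 0 \<and> (\<forall>y\<in>front. q \<bullet> y \<le> q \<bullet> x)" if "c > 0" "q = c *\<^sub>R n" for q c
    using that n by auto
  ultimately show ?thesis
    using n(1) by blast
qed

end

theorem theorem1p1:
  fixes a :: "real^2 \<Rightarrow> real"
  assumes cont: "continuous_on UNIV a"
    and pos: "\<forall>y. a y > 0"
    and per: "periodic2 a"
  shows "(\<forall>u v. u \<noteq> v \<and> \<not> rational_dir (v - u) \<longrightarrow>
              \<not> closed_segment u v \<subseteq> frontier (S_set a))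
       \<and> (\<forall>x \<in> frontier (D_set a). \<not> rational_dir x \<longrightarrow>
              (\<exists>n. n \<noteq> 0 \<and> (\<forall>q. q \<noteq> 0 \<and> (\<forall>y \<in> D_set a. q \<bullet> y \<le> q \<bullet> x)
                   \<longleftrightarrow> (\<exists>c>0. q = c *\<^sub>R n))))"
proof -
  have "a y \<noteq> 0" for y
    using pos by (metis less_irrefl)
  then interpret periodic_weight "\<lambda>y. 1 / a y"
    using assms by unfold_locales (auto simp: periodic2_def intro!: continuous_intros)
  have H: "Heff = eff_H a"
    by (simp add: Heff_def)
  have S: "S_set a = {p. Heff p \<le> 1}"
    by (simp add: S_set_def H)
  have D: "D_set a = front"
    using Heff_0 by (simp add: D_set_def front_def H)
  show ?thesis
    unfolding S D using unit_ball_no_irrational_segment front_unique_normal by blast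
qed

end
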